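(* Let $a_n\in\mathbb R$, $b_n>0$ ($n\ge0$), $b_{-1}=1$, be the recurrence coefficients of a normalized Hamburger moment problem, and consider the recurrence $$z r_n(z)=b_nr_{n+1}(z)+a_nr_n(z)+b_{n-1}r_{n-1}(z),\quad n\ge0.\qquad( * )$$ Assume that $$\sum_{n=1}^\infty\frac{1+|a_n|}{\sqrt{b_nb_{n-1}}}<\infty,$$ and that there is $n_0\ge1$ such that either $b_n^2\le b_{n-1}b_{n+1}$ for all $n\ge n_0$, or $b_n^2\ge b_{n-1}b_{n+1}$ for all $n\ge n_0$. For any non-trivial solution $(r_n)$ of $( * )$, i.e. with initial conditions $(r_0,r_{-1})\ne(0,0)$ not depending on $z$, there exists a constant $c$, depending on the $a_n,b_n$ and the initial conditions but independent of $z$, such that for all $z\in\mathbb C$ $$\sqrt{b_{n-1}}\,|r_n(z)|\le c\,\Pi(|z|),\quad n\ge0,\qquad \Pi(z)=\prod_{k=0}^\infty\Big(1+\frac{z}{b_{k-1}}\Big),$$ and for each $z\in\mathbb C$ there exists a constant $K_z>0$ such that $$\max\{|r_n(z)|,|r_{n+1}(z)|\}\ge\frac{K_z}{\sqrt{b_{n+1}}},\quad n\ge0.$$ In particular, $P_n^2(0),Q_n^2(0)=O(1/b_{n-1})$ as $n\to\infty$, and $$\frac{K}{b_{n+1}}\le|r_n(z)|^2+|r_{n+1}(z)|^2\le\frac{L}{b_{n-1}},\quad n\ge 0,$$ for suitable positive constants $K,L$ depending on $z$. Moreover, the moment problem is indeterminate.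
   Context: A normalized Hamburger moment problem is given by a sequence $s_n=\int_{-\infty}^\infty x^n\,d\mu(x)$, $n\ge0$, where $\mu$ is a probability measure on $\mathbb R$ with infinite support and moments of every order. It is indeterminate if more than one measure $\mu$ has these moments. The orthonormal polynomials $P_n$ (positive leading coefficients) and the polynomials of the second kind $Q_n$ are the solutions of the recurrence $( * )$ with initial conditions $P_0=1$, $P_{-1}=0$ and $Q_0=0$, $Q_{-1}=-1$ respectively. It is known that the problem is indeterminate if and only if $\sum_n(P_n^2(0)+Q_n^2(0))<\infty$. *)

theory Defs
  imports "HOL-Probability.Probability" "HOL-Computational_Algebra.Polynomial"
    "HOL-Library.Landau_Symbols"
begin

text \<open>
  All sequences of the three-term recurrence are indexed by \<^typ>\<open>int\<close>, because the index
  \<open>-1\<close> occurs; values at indices below \<open>-1\<close> (below \<open>0\<close> for \<open>a\<close>) are never used.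
\<close>

definition msupport :: "real measure \<Rightarrow> real set" where
  "msupport \<mu> = {x. \<forall>U. open U \<and> x \<in> U \<longrightarrow> emeasure \<mu> U > 0}"

definition has_moments :: "real measure \<Rightarrow> (nat \<Rightarrow> real) \<Rightarrow> bool" where
  "has_moments \<mu> s \<longleftrightarrow> sets \<mu> = sets borel \<and>
     (\<forall>n. integrable \<mu> (\<lambda>x. x ^ n) \<and> s n = (\<integral>x. x ^ n \<partial>\<mu>))"

definition normalized_hamburger :: "real measure \<Rightarrow> (nat \<Rightarrow> real) \<Rightarrow> bool" where
  "normalized_hamburger \<mu> s \<longleftrightarrow> prob_space \<mu> \<and> infinite (msupport \<mu>) \<and> has_moments \<mu> s"

definition indeterminate :: "(nat \<Rightarrow> real) \<Rightarrow> bool" where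
  "indeterminate s \<longleftrightarrow> (\<exists>\<mu> \<nu>. has_moments \<mu> s \<and> has_moments \<nu> s \<and> \<mu> \<noteq> \<nu>)"

definition orthonormal_polys :: "real measure \<Rightarrow> (int \<Rightarrow> real poly) \<Rightarrow> bool" where
  "orthonormal_polys \<mu> P \<longleftrightarrow>
     (\<forall>n\<ge>0. degree (P n) = nat n \<and> lead_coeff (P n) > 0) \<and>
     (\<forall>m\<ge>0. \<forall>n\<ge>0. (\<integral>x. poly (P m) x * poly (P n) x \<partial>\<mu>) = (if m = n then 1 else 0))"

definition solves_recurrence ::
  "(int \<Rightarrow> real) \<Rightarrow> (int \<Rightarrow> real) \<Rightarrow> (int \<Rightarrow> complex \<Rightarrow> complex) \<Rightarrow> bool" where
  "solves_recurrence a b r \<longleftrightarrow> (\<forall>z. \<forall>n\<ge>0.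
     z * r n z = of_real (b n) * r (n + 1) z + of_real (a n) * r n z
                 + of_real (b (n - 1)) * r (n - 1) z)"

definition nontrivial_solution ::
  "(int \<Rightarrow> real) \<Rightarrow> (int \<Rightarrow> real) \<Rightarrow> (int \<Rightarrow> complex \<Rightarrow> complex) \<Rightarrow> bool" where
  "nontrivial_solution a b r \<longleftrightarrow> solves_recurrence a b r \<and>
     (\<exists>\<alpha> \<beta>. (\<alpha>, \<beta>) \<noteq> (0, 0) \<and> (\<forall>z. r 0 z = \<alpha> \<and> r (-1) z = \<beta>))"

definition cpoly :: "real poly \<Rightarrow> complex \<Rightarrow> complex" where
  "cpoly p z = poly (map_poly of_real p) z"

definition polys_first_kind ::
  "(int \<Rightarrow> real) \<Rightarrow> (int \<Rightarrow> real) \<Rightarrow> (int \<Rightarrow> real poly) \<Rightarrow> bool" where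
  "polys_first_kind a b P \<longleftrightarrow>
     solves_recurrence a b (\<lambda>n. cpoly (P n)) \<and> P 0 = 1 \<and> P (-1) = 0"

definition polys_second_kind ::
  "(int \<Rightarrow> real) \<Rightarrow> (int \<Rightarrow> real) \<Rightarrow> (int \<Rightarrow> real poly) \<Rightarrow> bool" where
  "polys_second_kind a b Q \<longleftrightarrow>
     solves_recurrence a b (\<lambda>n. cpoly (Q n)) \<and> Q 0 = 0 \<and> Q (-1) = -1"

text \<open>
  The entire function \<open>\<Pi>\<close>, restricted to the real line; it is only evaluated at \<open>\<bar>z\<bar>\<close>.
  As \<^const>\<open>prodinf\<close> is unspecified on divergent products, statements about it need
  convergence as a separate claim.
\<close>

definition Pi_fun :: "(int \<Rightarrow> real) \<Rightarrow> real \<Rightarrow> real" where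
  "Pi_fun b x = (\<Prod>k::nat. 1 + x / b (int k - 1))"

end

theory Submission
  imports Defs "HOL-Real_Asymp.Real_Asymp" "HOL-Computational_Algebra.Fundamental_Theorem_Algebra"
begin

text \<open>
  Either form of log-regularity forces the \<open>b n\<close> to increase eventually, so that \<open>1 / b n\<close> is
  summable. After rescaling a solution by \<open>sqrt (b (n - 1))\<close> (forwards) or \<open>sqrt (b n)\<close>
  (backwards), the recurrence is a summable perturbation of a two-step recursion whose factors
  have bounded partial products; iterating it in the two directions gives the two bounds.

  The upper bound makes the sum of the squares of the orthonormal polynomials at every real point
  finite. Fix a point \<open>x0\<close> which is neither an atom of the given measure nor a zero of an
  orthonormal polynomial. Gaussian quadrature with a node at \<open>x0\<close> gives discrete measures
  matching more and more moments, whose mass at \<open>x0\<close> is bounded away from zero. By Helly's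
  theorem they accumulate at a measure with the same moments and an atom at \<open>x0\<close>, hence
  different from the given one.
\<close>

section \<open>Log-regular coefficients\<close>

text \<open>Weighting r_n by \<open>sqrt (b (n - 1))\<close> turns the coefficient of the older term
  into b_n / sqrt(b_{n-1} b_{n+1}), and log-regularity says that this quotient eventually stays on
  one side of 1. Below 1 it is harmless. Above 1 its products must be bounded, and they are, because
  the ratios b_{n+1} / b_n decrease without falling below 1.

  The two bounds treat |z| differently. The upper constant must not depend on z, so |z| cannot join
  the summable perturbation: each step instead contributes one factor of the product
  \<open>Pi_fun\<close>. In the lower bound z is fixed, and |z| is simply added to |a_n|.

  The quadrature weight at x0 is the reciprocal of the sum of P_k(x0)^2 over k < N, so summability
  is what keeps the mass there away from zero. That x0 is not a zero gives the quasi-orthogonal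
  polynomial its full degree. Weak convergence alone does not carry moments to the limit; here every
  moment is eventually constant along the sequence, and higher moments control the tails of lower
  ones uniformly.\<close>

lemma summable_bounded_away:
  fixes f :: "nat \<Rightarrow> real"
  assumes "summable f" "c > 0" "\<And>n. n \<ge> m \<Longrightarrow> c \<le> f n"
  shows False
proof -
  have "f \<longlonglongrightarrow> 0" by (rule summable_LIMSEQ_zero[OF assms(1)])
  then have "\<forall>\<^sub>F n in sequentially. f n < c"
    using assms(2) by (rule order_tendstoD)
  then obtain N where N: "\<And>n. n \<ge> N \<Longrightarrow> f n < c"
    by (auto simp: eventually_sequentially)
  have "f (max m N) < c" by (rule N) simp
  with assms(3)[of "max m N"] show False by simp
qed

text \<open>Indexed by natural numbers: \<open>B n\<close> stands for b_{n-1}, whereas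
  \<open>A n\<close> stands for a_n, so that \<open>B 0\<close> is b_{-1}.\<close>

locale log_regular =
  fixes A B :: "nat \<Rightarrow> real"
  assumes B_pos: "B n > 0"
    and summable_coeffs: "summable (\<lambda>n. (1 + \<bar>A (n + 1)\<bar>) / sqrt (B (n + 2) * B (n + 1)))"
    and regular: "\<exists>m0. (\<forall>m\<ge>m0. (B (m + 1))\<^sup>2 \<le> B m * B (m + 2)) \<or>
                       (\<forall>m\<ge>m0. (B (m + 1))\<^sup>2 \<ge> B m * B (m + 2))"
begin

lemma B_nonneg [simp]: "0 \<le> B n" and B_nonzero [simp]: "B n \<noteq> 0"
  using B_pos[of n] by auto

lemma summable_sqrt: "summable (\<lambda>n. 1 / sqrt (B (n + 2) * B (n + 1)))"
proof (rule summable_comparison_test'[OF summable_coeffs])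
  fix n show "norm (1 / sqrt (B (n + 2) * B (n + 1))) \<le> (1 + \<bar>A (n + 1)\<bar>) / sqrt (B (n + 2) * B (n + 1))"
    by (simp add: divide_right_mono)
qed

text \<open>If \<open>B\<close> decreased from \<open>m\<close> on, the terms of the summable series
  would stay above \<open>1 / B m\<close>.\<close>

lemma not_eventually_decreasing: "\<not> (\<forall>n\<ge>m. B (n + 1) \<le> B n)"
proof
  assume dec: "\<forall>n\<ge>m. B (n + 1) \<le> B n"
  have le: "B n \<le> B m" if "n \<ge> m" for n
    using that by (induction n rule: dec_induct) (use dec in \<open>auto intro: order_trans\<close>)
  have "1 / B m \<le> 1 / sqrt (B (n + 2) * B (n + 1))" if "n \<ge> m" for n
  proof -
    have "B (n + 2) * B (n + 1) \<le> B m * B m"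
      using that by (intro mult_mono le) auto
    then have "sqrt (B (n + 2) * B (n + 1)) \<le> B m"
      by (metis B_nonneg abs_of_nonneg real_sqrt_abs2 real_sqrt_le_mono)
    then show ?thesis
      using B_pos by (intro divide_left_mono) auto
  qed
  from summable_bounded_away[OF summable_sqrt _ this] show False using B_pos by auto
qed

text \<open>In the log-convex case the ratios of neighbours increase, so one ratio of at least 1,
  which exists as \<open>B\<close> does not decrease for good, forces all later ones. In the
  log-concave case they decrease, so a single ratio below 1 would make \<open>B\<close> decrease for
  good.\<close>

lemma eventually_increasing: obtains m1 where "\<And>m. m \<ge> m1 \<Longrightarrow> B m \<le> B (m + 1)"
proof -
  from regular obtain m0 where "(\<forall>m\<ge>m0. (B (m + 1))\<^sup>2 \<le> B m * B (m + 2)) \<or>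
                       (\<forall>m\<ge>m0. (B (m + 1))\<^sup>2 \<ge> B m * B (m + 2))" by blast
  then show ?thesis
  proof
    assume conv: "\<forall>m\<ge>m0. (B (m + 1))\<^sup>2 \<le> B m * B (m + 2)"
    from not_eventually_decreasing[of m0] obtain m where m: "m \<ge> m0" "B m \<le> B (m + 1)"
      by (meson linear)
    have "B n \<le> B (n + 1)" if "n \<ge> m" for n
      using that
    proof (induction n rule: dec_induct)
      case (step n)
      have "B n * B (n + 1) \<le> (B (n + 1))\<^sup>2"
        unfolding power2_eq_square using step by (intro mult_right_mono) auto
      also have "\<dots> \<le> B n * B (n + 2)" using conv step m by auto
      finally show ?case using B_pos[of n] by simp
    qed (use m in auto)
    then show ?thesis using that by blast
  next
    assume conc: "\<forall>m\<ge>m0. (B (m + 1))\<^sup>2 \<ge> B m * B (m + 2)"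
    have "B m \<le> B (m + 1)" if m: "m \<ge> m0" for m
    proof (rule ccontr)
      assume "\<not> B m \<le> B (m + 1)"
      then have m': "B (m + 1) \<le> B m" by simp
      have "B (n + 1) \<le> B n" if "n \<ge> m" for n
        using that
      proof (induction n rule: dec_induct)
        case (step n)
        have "B n * B (n + 2) \<le> (B (n + 1))\<^sup>2" using conc step m by auto
        also have "\<dots> \<le> B n * B (n + 1)"
          unfolding power2_eq_square using step by (intro mult_right_mono) auto
        finally show ?case using B_pos[of n] by simp
      qed (use m' in auto)
      then show False using not_eventually_decreasing[of m] by blast
    qed
    then show ?thesis using that by blast
  qed
qed

text \<open>By monotonicity the geometric mean of two neighbours is at most the later one.\<close>

lemma summable_inverse: "summable (\<lambda>n. 1 / B n)"
proof -
  obtain m1 where m1: "\<And>m. m \<ge> m1 \<Longrightarrow> B m \<le> B (m + 1)" by (rule eventually_increasing) blast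
  have "summable (\<lambda>n. 1 / B (n + 2))"
  proof (rule summable_comparison_test'[OF summable_sqrt])
    fix n assume n: "n \<ge> m1"
    have "sqrt (B (n + 2) * B (n + 1)) \<le> sqrt (B (n + 2) * B (n + 2))"
      using m1[of "n + 1"] n by (intro real_sqrt_le_mono mult_left_mono) auto
    then show "norm (1 / B (n + 2)) \<le> 1 / sqrt (B (n + 2) * B (n + 1))"
      using B_pos by (auto intro!: divide_left_mono)
  qed
  then show ?thesis using summable_iff_shift[of "\<lambda>n. 1 / B n" 2] by simp
qed

text \<open>Serves to turn a bound by \<open>1 / B (n + 1)\<close> into one by
  \<open>1 / B n\<close>.\<close>

lemma ratio_bounded_below: obtains c where "c > 0" "\<And>n. c * B n \<le> B (n + 1)"
proof -
  obtain m1 where m1: "\<And>m. m \<ge> m1 \<Longrightarrow> B m \<le> B (m + 1)" by (rule eventually_increasing) blast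
  define c where "c = Min (insert 1 ((\<lambda>n. B (n + 1) / B n) ` {..<m1}))"
  have "c > 0" unfolding c_def using B_pos by (subst Min_gr_iff) auto
  moreover have "c * B n \<le> B (n + 1)" for n
  proof (cases "n < m1")
    case True
    then have "c \<le> B (n + 1) / B n" unfolding c_def by (intro Min_le) auto
    then show ?thesis using B_pos[of n] by (simp add: field_simps)
  next
    case False
    have "c \<le> 1" unfolding c_def by (intro Min_le) auto
    then have "c * B n \<le> 1 * B n" by (intro mult_right_mono) auto
    with m1[of n] False show ?thesis by auto
  qed
  ultimately show ?thesis using that by blast
qed

text \<open>The coefficient of the older term in the rescaled recursion, in both directions. It is
  the square root of the quotient of two consecutive ratios \<open>B (n + 1) / B n\<close>, hence at
  most 1 under log-convexity.\<close>

definition kap :: "nat \<Rightarrow> real" where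
  "kap n = B (n + 1) / sqrt (B n * B (n + 2))"

lemma kap_nonneg [simp]: "kap n \<ge> 0"
  by (simp add: kap_def)

text \<open>In the log-concave case the product of the factors \<open>kap\<close> telescopes in the ratios of
  consecutive coefficients, which decrease to a limit \<open>\<ge> 1\<close>.\<close>

lemma kap_majorant:
  obtains D :: "nat \<Rightarrow> real" and C m1
  where "\<And>n. n \<ge> m1 \<Longrightarrow> 1 \<le> D n" "\<And>n. n \<ge> m1 \<Longrightarrow> D n \<le> C"
    "\<And>n. n \<ge> m1 \<Longrightarrow> D n \<le> D (n + 1)" "\<And>n. n \<ge> m1 \<Longrightarrow> kap n * D n \<le> D (n + 1)"
proof -
  obtain m1 where m1: "\<And>m. m \<ge> m1 \<Longrightarrow> B m \<le> B (m + 1)" by (rule eventually_increasing) blast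
  from regular obtain m0 where "(\<forall>m\<ge>m0. (B (m + 1))\<^sup>2 \<le> B m * B (m + 2)) \<or>
                       (\<forall>m\<ge>m0. (B (m + 1))\<^sup>2 \<ge> B m * B (m + 2))" by blast
  then show ?thesis
  proof
    assume conv: "\<forall>m\<ge>m0. (B (m + 1))\<^sup>2 \<le> B m * B (m + 2)"
    have "kap n \<le> 1" if "n \<ge> m0" for n
    proof -
      have "B (n + 1) \<le> sqrt (B n * B (n + 2))"
        using conv that by (intro real_le_rsqrt) auto
      then show ?thesis unfolding kap_def using B_pos by (subst divide_le_eq_1_pos) auto
    qed
    then show ?thesis using that[of m0 "\<lambda>_. 1" 1] by auto
  next
    assume conc: "\<forall>m\<ge>m0. (B (m + 1))\<^sup>2 \<ge> B m * B (m + 2)"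
    define m where "m = max m0 m1"
    define q where "q n = B (n + 1) / B n" for n
    \<comment> \<open>Chosen so that \<open>kap n\<close> equals \<open>D (n + 1) / D n\<close>;
      since \<open>q n\<close> is at least 1, \<open>D\<close> is bounded by
      \<open>sqrt (q m)\<close>.\<close>
    define D where "D n = sqrt (q m / q n)" for n
    have qpos: "q n > 0" for n using B_pos by (auto simp: q_def)
    have q1: "q n \<ge> 1" if "n \<ge> m" for n
      using m1[of n] that B_pos[of n] by (auto simp: q_def m_def)
    have qdec: "q (n + 1) \<le> q n" if "n \<ge> m" for n
    proof -
      have "B n * B (n + 2) \<le> (B (n + 1))\<^sup>2" using conc that by (auto simp: m_def)
      then show ?thesis using B_pos by (auto simp: q_def field_simps power2_eq_square)
    qed
    have qle: "q n \<le> q m" if "n \<ge> m" for n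
      using that by (induction n rule: dec_induct) (use qdec in \<open>auto intro: order_trans\<close>)
    have "D n \<le> D (n + 1)" if "n \<ge> m" for n
      unfolding D_def using qdec[OF that] qpos less_imp_le[OF qpos] 
      by (intro real_sqrt_le_mono divide_left_mono) auto
    moreover have "kap n * D n \<le> D (n + 1)" for n
    proof -
      have "kap n = sqrt (q n / q (n + 1))"
      proof -
        have "q n / q (n + 1) = (B (n + 1))\<^sup>2 / (B n * B (n + 2))"
          by (simp add: q_def power2_eq_square)
        then show ?thesis by (simp add: kap_def real_sqrt_divide)
      qed
      then have "kap n * D n = D (n + 1)"
        using qpos[of n] by (simp add: D_def flip: real_sqrt_mult)
      then show ?thesis by simp
    qed
    moreover have "1 \<le> D n" if "n \<ge> m" for n
      using qle[OF that] qpos[of n] by (simp add: D_def)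
    moreover have "D n \<le> sqrt (q m)" if "n \<ge> m" for n
      unfolding D_def using q1[OF that] qpos[of n] qpos[of m]
      by (intro real_sqrt_le_mono) (simp add: divide_le_eq)
    ultimately show ?thesis using that[of m D "sqrt (q m)"] by auto
  qed
qed

text \<open>A discrete Gronwall argument: the majorant of \<open>kap_majorant\<close> is multiplied
  by the partial products of 1 + \<alpha>, which stay below the exponential of the sum. A recursion
  with coefficients \<alpha> and \<open>kap\<close> then preserves bounds by \<open>K * D n\<close>
  on two consecutive values.\<close>

lemma kap_plus_summable_majorant:
  fixes \<alpha> :: "nat \<Rightarrow> real"
  assumes "summable \<alpha>" "\<And>n. \<alpha> n \<ge> 0"
  obtains D :: "nat \<Rightarrow> real" and C m1
  where "\<And>n. n \<ge> m1 \<Longrightarrow> 1 \<le> D n" "\<And>n. n \<ge> m1 \<Longrightarrow> D n \<le> C"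
    "\<And>n. n \<ge> m1 \<Longrightarrow> D n \<le> D (n + 1)" "\<And>n. n \<ge> m1 \<Longrightarrow> (\<alpha> n + kap n) * D n \<le> D (n + 1)"
proof -
  obtain D C m1 where D:
    "\<And>n. n \<ge> m1 \<Longrightarrow> 1 \<le> D n" "\<And>n. n \<ge> m1 \<Longrightarrow> D n \<le> C"
    "\<And>n. n \<ge> m1 \<Longrightarrow> D n \<le> D (n + 1)" "\<And>n. n \<ge> m1 \<Longrightarrow> kap n * D n \<le> D (n + 1)"
    by (rule kap_majorant) blast
  define F where "F n = (\<Prod>k<n. 1 + \<alpha> k)" for n
  have F1: "1 \<le> F n" for n unfolding F_def by (intro prod_ge_1) (use assms in auto)
  have F_Suc: "F (n + 1) = F n * (1 + \<alpha> n)" for n by (simp add: F_def)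
  have F_le: "F n \<le> exp (suminf \<alpha>)" for n
  proof -
    have "F n \<le> (\<Prod>k<n. exp (\<alpha> k))" unfolding F_def
      using assms(2) by (intro prod_mono) (auto simp: exp_ge_add_one_self add_nonneg_nonneg)
    also have "\<dots> = exp (\<Sum>k<n. \<alpha> k)" by (simp add: exp_sum)
    also have "\<dots> \<le> exp (suminf \<alpha>)" using assms by (auto intro: sum_le_suminf)
    finally show ?thesis .
  qed
  show ?thesis
  proof (rule that[of m1 "\<lambda>n. D n * F n" "C * exp (suminf \<alpha>)"])
    fix n assume n: "n \<ge> m1"
    have pos: "0 \<le> D n" "0 \<le> F n" "0 \<le> \<alpha> n" "0 \<le> C"
      using D(1)[OF n] F1[of n] assms(2)[of n] D(2)[OF n] by auto
    show "1 \<le> D n * F n" using mult_mono[OF D(1)[OF n] F1[of n]] pos by simp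
    show "D n * F n \<le> C * exp (suminf \<alpha>)" by (intro mult_mono D n F_le pos)
    show "D n * F n \<le> D (n + 1) * F (n + 1)"
      unfolding F_Suc using pos D(1)[of "n + 1"] n
      by (intro mult_mono D(3)) (auto simp: mult_le_cancel_left1)
    have "(\<alpha> n + kap n) * (D n * F n) = (\<alpha> n * D n + kap n * D n) * F n"
      by (simp add: algebra_simps)
    \<comment> \<open>Monotonicity of \<open>D\<close> is used on the \<alpha> term, so that the
      factor 1 + \<alpha> n splits off.\<close>
    also have "\<dots> \<le> (\<alpha> n * D (n + 1) + D (n + 1)) * F n"
      by (intro mult_right_mono add_mono mult_left_mono D n pos)
    also have "\<dots> = D (n + 1) * F (n + 1)"
      unfolding F_Suc by (simp add: algebra_simps)
    finally show "(\<alpha> n + kap n) * (D n * F n) \<le> D (n + 1) * F (n + 1)" .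
  qed
qed

text \<open>Negative arguments are covered as well, since \<open>convergent_prod\<close> tolerates
  finitely many vanishing factors.\<close>

lemma convergent_prod_inverse: "convergent_prod (\<lambda>k. 1 + x / B k)" for x :: real
proof (rule abs_convergent_prod_imp_convergent_prod)
  have "summable (\<lambda>k. \<bar>x\<bar> * (1 / B k))" by (intro summable_mult summable_inverse)
  then show "abs_convergent_prod (\<lambda>k. 1 + x / B k)"
    by (simp add: abs_convergent_prod_conv_summable abs_divide)
qed

lemma prod_le_prodinf_inverse: "(\<Prod>k<n. 1 + x / B k) \<le> (\<Prod>k. 1 + x / B k)" if "x \<ge> 0" for x :: real
  using that by (intro prod_le_prodinf[OF convergent_prod_has_prod[OF convergent_prod_inverse]])
    (auto intro!: add_nonneg_nonneg)

end

section \<open>Growth of solutions\<close>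

text \<open>\<open>R n\<close> stands for r_{n-1}, so \<open>\<rho>0\<close> is r_{-1} and
  \<open>\<rho>1\<close> is r_0.\<close>

locale log_regular_solution = log_regular +
  fixes R :: "nat \<Rightarrow> complex \<Rightarrow> complex" and \<rho>0 \<rho>1 :: complex
  assumes rec: "z * R (n + 1) z = of_real (B (n + 1)) * R (n + 2) z
      + of_real (A n) * R (n + 1) z + of_real (B n) * R n z"
    and R_0: "R 0 z = \<rho>0" and R_1: "R 1 z = \<rho>1"
begin

section \<open>Inequalities for single steps of the recurrence\<close>

lemma forward_bound:
  "B (n + 1) * cmod (R (n + 2) z) \<le> (cmod z + \<bar>A n\<bar>) * cmod (R (n + 1) z) + B n * cmod (R n z)"
proof -
  have "of_real (B (n + 1)) * R (n + 2) z = (z - of_real (A n)) * R (n + 1) z - of_real (B n) * R n z"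
    using rec[of z n] by (simp add: algebra_simps)
  then have "B (n + 1) * cmod (R (n + 2) z) = cmod ((z - of_real (A n)) * R (n + 1) z - of_real (B n) * R n z)"
    by (metis B_nonneg abs_of_nonneg norm_mult norm_of_real)
  also have "\<dots> \<le> cmod (z - of_real (A n)) * cmod (R (n + 1) z) + B n * cmod (R n z)"
    by (rule order_trans[OF norm_triangle_ineq4]) (simp add: norm_mult)
  also have "cmod (z - of_real (A n)) \<le> cmod z + \<bar>A n\<bar>"
    by (rule order_trans[OF norm_triangle_ineq4]) simp
  finally show ?thesis by (simp add: mult_right_mono)
qed

lemma backward_bound:
  "B n * cmod (R n z) \<le> (cmod z + \<bar>A n\<bar>) * cmod (R (n + 1) z) + B (n + 1) * cmod (R (n + 2) z)"
proof -
  have "of_real (B n) * R n z = (z - of_real (A n)) * R (n + 1) z - of_real (B (n + 1)) * R (n + 2) z"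
    using rec[of z n] by (simp add: algebra_simps)
  then have "B n * cmod (R n z) = cmod ((z - of_real (A n)) * R (n + 1) z - of_real (B (n + 1)) * R (n + 2) z)"
    by (metis B_nonneg abs_of_nonneg norm_mult norm_of_real)
  also have "\<dots> \<le> cmod (z - of_real (A n)) * cmod (R (n + 1) z) + B (n + 1) * cmod (R (n + 2) z)"
    by (rule order_trans[OF norm_triangle_ineq4]) (simp add: norm_mult)
  also have "cmod (z - of_real (A n)) \<le> cmod z + \<bar>A n\<bar>"
    by (rule order_trans[OF norm_triangle_ineq4]) simp
  finally show ?thesis by (simp add: mult_right_mono)
qed

text \<open>The constant may depend on \<open>n\<close> but not on \<open>z\<close>. This starts the
  induction for the upper bound, which works only from some index on, and covers the finitely many
  indices before it.\<close>

lemma polynomial_growth: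
  "\<exists>C\<ge>0. \<forall>z. cmod (R n z) \<le> C * (\<Prod>k<n. 1 + cmod z / B k) \<and>
              cmod (R (n + 1) z) \<le> C * (\<Prod>k<n. 1 + cmod z / B k)"
proof (induction n)
  case 0
  show ?case by (rule exI[of _ "max (cmod \<rho>0) (cmod \<rho>1)"]) (auto simp: R_0 R_1[simplified] le_max_iff_disj)
next
  case (Suc n)
  then obtain C where C: "C \<ge> 0" "\<And>z. cmod (R n z) \<le> C * (\<Prod>k<n. 1 + cmod z / B k)"
     "\<And>z. cmod (R (n + 1) z) \<le> C * (\<Prod>k<n. 1 + cmod z / B k)" by blast
  \<comment> \<open>The numerator is chosen so that its product with 1 + |z| / \<open>B n\<close>
    dominates |z| + |\<open>A n\<close>| + \<open>B n\<close>, the sum of the coefficients in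
    \<open>forward_bound\<close>.\<close>
  define K where "K = (B n + \<bar>A n\<bar> + B n) / B (n + 1)"
  have K0: "K \<ge> 0" by (simp add: K_def)
  show ?case
  proof (intro exI conjI allI)
    show "0 \<le> max C (K * C)" using C by simp
    fix z
    define E where "E = (\<Prod>k<n. 1 + cmod z / B k)"
    have E: "E \<ge> 0" unfolding E_def by (intro prod_nonneg) (auto intro!: add_nonneg_nonneg)
    have fac: "1 \<le> 1 + cmod z / B n" by simp
    have ES: "(\<Prod>k<Suc n. 1 + cmod z / B k) = E * (1 + cmod z / B n)" by (simp add: E_def)
    have CE: "0 \<le> C * E" using C E by simp
    have "cmod (R (n + 1) z) \<le> C * E" using C(3) by (simp add: E_def)
    also have "\<dots> \<le> C * (E * (1 + cmod z / B n))"
      using mult_left_mono[OF fac CE] by (simp add: mult.assoc)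
    also have "\<dots> \<le> max C (K * C) * (E * (1 + cmod z / B n))"
      using E by (intro mult_right_mono) auto
    finally show "cmod (R (Suc n) z) \<le> max C (K * C) * (\<Prod>k<Suc n. 1 + cmod z / B k)"
      unfolding ES by simp
    have "B (n + 1) * cmod (R (n + 2) z) \<le> (cmod z + \<bar>A n\<bar>) * (C * E) + B n * (C * E)"
      by (rule order_trans[OF forward_bound]) (use C in \<open>auto simp: E_def intro!: add_mono mult_left_mono\<close>)
    also have "\<dots> = (cmod z + \<bar>A n\<bar> + B n) * (C * E)" by (simp add: algebra_simps)
    also have "\<dots> \<le> ((B n + \<bar>A n\<bar> + B n) * (1 + cmod z / B n)) * (C * E)"
    proof (rule mult_right_mono[OF _ CE])
      have "(B n + \<bar>A n\<bar> + B n) * (1 + cmod z / B n)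
          = cmod z + \<bar>A n\<bar> + B n + (B n + cmod z + \<bar>A n\<bar> * (cmod z / B n))"
        using B_pos[of n] by (simp add: field_simps)
      moreover have "0 \<le> B n + cmod z + \<bar>A n\<bar> * (cmod z / B n)" by (simp add: add_nonneg_nonneg)
      ultimately show "cmod z + \<bar>A n\<bar> + B n \<le> (B n + \<bar>A n\<bar> + B n) * (1 + cmod z / B n)" by linarith
    qed
    finally have "cmod (R (n + 2) z) \<le>
        ((B n + \<bar>A n\<bar> + B n) * (1 + cmod z / B n)) * (C * E) / B (n + 1)"
      using B_pos[of "n + 1"] by (subst pos_le_divide_eq) (simp_all add: mult.commute)
    also have "\<dots> = (K * C) * (E * (1 + cmod z / B n))" by (simp add: K_def)
    also have "\<dots> \<le> max C (K * C) * (E * (1 + cmod z / B n))"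
      using E by (intro mult_right_mono) auto
    finally show "cmod (R (Suc n + 1) z) \<le> max C (K * C) * (\<Prod>k<Suc n. 1 + cmod z / B k)"
      unfolding ES by simp
  qed
qed

text \<open>This is \<open>forward_bound\<close> at \<open>n + 1\<close> divided by
  \<open>sqrt (B (n + 2))\<close>. The terms in |z| and in \<open>A\<close> are kept apart because
  they are absorbed by different majorants.\<close>

lemma normalized_forward:
  fixes n z
  defines "s \<equiv> sqrt (B (n + 2) * B (n + 1))"
  shows "sqrt (B (n + 2)) * cmod (R (n + 3) z) \<le>
    (cmod z / s + \<bar>A (n + 1)\<bar> / s) * (sqrt (B (n + 1)) * cmod (R (n + 2) z))
     + kap n * (sqrt (B n) * cmod (R (n + 1) z))"
proof -
  have sq: "sqrt (B k) * sqrt (B k) = B k" "sqrt (B k) > 0" for k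
    using B_pos[of k] by auto
  have "sqrt (B (n + 2)) * (sqrt (B (n + 2)) * cmod (R (n + 3) z)) = B (n + 2) * cmod (R (n + 3) z)"
    by (simp flip: mult.assoc)
  also have "\<dots> \<le> (cmod z + \<bar>A (n + 1)\<bar>) * cmod (R (n + 2) z) + B (n + 1) * cmod (R (n + 1) z)"
    using forward_bound[of "n + 1" z] by (simp add: numeral_eq_Suc)
  also have "\<dots> = sqrt (B (n + 2)) * ((cmod z / s + \<bar>A (n + 1)\<bar> / s) * (sqrt (B (n + 1)) * cmod (R (n + 2) z))
     + kap n * (sqrt (B n) * cmod (R (n + 1) z)))"
    unfolding s_def kap_def real_sqrt_mult using sq(2)[of n] sq(2)[of "n + 1"] sq(2)[of "n + 2"]
    by (simp add: field_simps)
  finally show ?thesis using sq(2)[of "n + 2"] by simp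
qed

text \<open>The weight of \<open>R (n + 1)\<close> is now \<open>sqrt (B (n + 1))\<close>, not
  \<open>sqrt (B n)\<close>: with the forward weight the coefficient of the last term would be
  \<open>1 / kap n\<close> rather than a value of \<open>kap\<close>.\<close>

lemma normalized_backward:
  fixes n z
  defines "s \<equiv> sqrt (B (n + 2) * B (n + 1))"
  shows "sqrt (B (n + 1)) * cmod (R (n + 1) z) \<le>
    ((cmod z + \<bar>A (n + 1)\<bar>) / s) * (sqrt (B (n + 2)) * cmod (R (n + 2) z))
     + kap (n + 1) * (sqrt (B (n + 3)) * cmod (R (n + 3) z))"
proof -
  have sq: "sqrt (B k) * sqrt (B k) = B k" "sqrt (B k) > 0" for k
    using B_pos[of k] by auto
  have "sqrt (B (n + 1)) * (sqrt (B (n + 1)) * cmod (R (n + 1) z)) = B (n + 1) * cmod (R (n + 1) z)"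
    by (simp flip: mult.assoc)
  also have "\<dots> \<le> (cmod z + \<bar>A (n + 1)\<bar>) * cmod (R (n + 2) z) + B (n + 2) * cmod (R (n + 3) z)"
    using backward_bound[of "n + 1" z] by (simp add: numeral_eq_Suc)
  also have "\<dots> = sqrt (B (n + 1)) * (((cmod z + \<bar>A (n + 1)\<bar>) / s) * (sqrt (B (n + 2)) * cmod (R (n + 2) z))
     + kap (n + 1) * (sqrt (B (n + 3)) * cmod (R (n + 3) z)))"
    unfolding s_def kap_def real_sqrt_mult
    using sq(2)[of "n + 3"] sq(2)[of "n + 1"] sq(2)[of "n + 2"]
    by (simp add: field_simps numeral_eq_Suc)
  finally show ?thesis using sq(2)[of "n + 1"] by simp
qed

theorem upper_bound:
  "\<exists>c. \<forall>z n. sqrt (B n) * cmod (R (n + 1) z) \<le> c * (\<Prod>k. 1 + cmod z / B k)"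
proof -
  define u where "u n z = sqrt (B n) * cmod (R (n + 1) z)" for n z
  define E where "E n z = (\<Prod>k<n. 1 + cmod z / B k)" for n z
  have E_pos: "E n z > 0" for n z unfolding E_def
    by (intro prod_pos) (use B_pos in \<open>auto intro!: add_pos_nonneg\<close>)
  have E_Suc: "E (Suc n) z = E n z * (1 + cmod z / B n)" for n z by (simp add: E_def)
  have E_mono: "E n z \<le> E (Suc n) z" for n z
    using E_pos[of n z] by (simp add: E_Suc mult_le_cancel_left1)
  have E_Pi: "E n z \<le> (\<Prod>k. 1 + cmod z / B k)" for n z
    unfolding E_def by (rule prod_le_prodinf_inverse) simp
  obtain m1 where m1: "\<And>m. m \<ge> m1 \<Longrightarrow> B m \<le> B (m + 1)" by (rule eventually_increasing) blast
  define \<alpha> where "\<alpha> n = \<bar>A (n + 1)\<bar> / sqrt (B (n + 2) * B (n + 1))" for n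
  have \<alpha>0: "\<alpha> n \<ge> 0" for n by (simp add: \<alpha>_def)
  have "summable \<alpha>"
    by (rule summable_comparison_test'[OF summable_coeffs]) (auto simp: \<alpha>_def intro!: divide_right_mono)
  then obtain D C m2 where D: "\<And>n. n \<ge> m2 \<Longrightarrow> 1 \<le> D n" "\<And>n. n \<ge> m2 \<Longrightarrow> D n \<le> C"
    "\<And>n. n \<ge> m2 \<Longrightarrow> D n \<le> D (n + 1)" "\<And>n. n \<ge> m2 \<Longrightarrow> (\<alpha> n + kap n) * D n \<le> D (n + 1)"
    using kap_plus_summable_majorant \<alpha>0 by metis
  define m where "m = max m1 m2"
  have u_init: "\<exists>K\<ge>0. \<forall>z. u n z \<le> K * E (n + 1) z \<and> u (n + 1) z \<le> K * E (n + 1) z" for n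
  proof -
    obtain K where K: "K \<ge> 0" "\<And>z. cmod (R (n + 1) z) \<le> K * E (n + 1) z"
      "\<And>z. cmod (R (n + 2) z) \<le> K * E (n + 1) z"
      using polynomial_growth[of "n + 1"] by (auto simp: E_def)
    define S where "S = max (sqrt (B n)) (sqrt (B (n + 1)))"
    have "u n z \<le> S * K * E (n + 1) z" for z
      unfolding u_def mult.assoc by (intro mult_mono K) (auto simp: S_def le_max_iff_disj)
    moreover have "u (n + 1) z \<le> S * K * E (n + 1) z" for z
      unfolding u_def mult.assoc using K(3)[of z] by (intro mult_mono) (auto simp: S_def le_max_iff_disj)
    moreover have "S * K \<ge> 0" using K by (auto simp: S_def le_max_iff_disj)
    ultimately show ?thesis by blast
  qed
  obtain K where K: "K \<ge> 0" "\<And>z. u m z \<le> K * E (m + 1) z" "\<And>z. u (m + 1) z \<le> K * E (m + 1) z"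
    using u_init by blast
  \<comment> \<open>Two consecutive values share one bound, as a two-step recursion requires. In a
    step the |z| term is paid for by the new factor of \<open>E\<close>, the other two by passing
    from \<open>D n\<close> to \<open>D (n + 1)\<close>.\<close>
  have u_late: "u n z \<le> K * D n * E (n + 1) z \<and> u (n + 1) z \<le> K * D n * E (n + 1) z"
    if "n \<ge> m" for n z
    using that
  proof (induction n rule: dec_induct)
    case base
    have "K * E (m + 1) z \<le> K * D m * E (m + 1) z"
      using D(1)[of m] K E_pos[of "m + 1" z]
      by (intro mult_right_mono) (auto simp: m_def mult_le_cancel_left1)
    with K(2,3)[of z] show ?case by linarith
  next
    case (step n)
    have n: "n \<ge> m1" "n \<ge> m2" using step by (auto simp: m_def)
    define s where "s = sqrt (B (n + 2) * B (n + 1))"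
    define x where "x = K * E (n + 1) z"
    have x: "x \<ge> 0" using K E_pos[of "n + 1" z] by (simp add: x_def)
    have IH: "u n z \<le> D n * x" "u (n + 1) z \<le> D n * x"
      using step by (auto simp: x_def mult_ac)
    have Dn: "0 \<le> D n" "0 \<le> D (n + 1)" using D(1)[of n] D(1)[of "n + 1"] n by auto
    \<comment> \<open>Monotonicity of \<open>B\<close> replaces the geometric mean by
      \<open>B (n + 1)\<close>, so that z contributes precisely the factor by which
      \<open>E (n + 2) z\<close> exceeds \<open>E (n + 1) z\<close>.\<close>
    have s: "B (n + 1) \<le> s"
    proof -
      have "B (n + 1) * B (n + 1) \<le> B (n + 2) * B (n + 1)"
        using m1[of "n + 1"] n by (intro mult_right_mono) auto
      then show ?thesis unfolding s_def by (intro real_le_rsqrt) (simp add: power2_eq_square)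
    qed
    have zs: "cmod z / s \<le> cmod z / B (n + 1)"
      using s B_pos[of "n + 1"] by (intro divide_left_mono) auto
    have zs0: "0 \<le> cmod z / s" by (simp add: s_def)
    have "u (n + 2) z \<le> (cmod z / s + \<alpha> n) * u (n + 1) z + kap n * u n z"
      using normalized_forward[of n z] by (simp add: u_def s_def \<alpha>_def numeral_eq_Suc)
    also have "\<dots> \<le> (cmod z / s + \<alpha> n) * (D n * x) + kap n * (D n * x)"
      using IH \<alpha>0 zs0 by (intro add_mono mult_left_mono) auto
    also have "\<dots> = (cmod z / s) * (D n * x) + ((\<alpha> n + kap n) * D n) * x"
      by (simp add: algebra_simps)
    also have "\<dots> \<le> (cmod z / B (n + 1)) * (D (n + 1) * x) + D (n + 1) * x"
      using zs zs0 D(3,4)[OF n(2)] x Dn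
      by (intro add_mono mult_mono mult_right_mono) auto
    also have "\<dots> = K * D (n + 1) * E (n + 2) z"
      using E_Suc[of "n + 1" z] by (simp add: x_def algebra_simps)
    finally have 1: "u (n + 2) z \<le> K * D (n + 1) * E (n + 2) z" .
    have "u (n + 1) z \<le> D n * x" by (rule IH)
    also have "\<dots> \<le> D (n + 1) * x" using D(3)[OF n(2)] x by (rule mult_right_mono)
    also have "\<dots> = K * D (n + 1) * E (n + 1) z" by (simp add: x_def)
    also have "\<dots> \<le> K * D (n + 1) * E (n + 2) z"
      using E_mono[of "n + 1" z] K Dn by (intro mult_left_mono) auto
    finally show ?case using 1 by simp
  qed
  have "\<exists>K. \<forall>n. K n \<ge> 0 \<and> (\<forall>z. u n z \<le> K n * E (n + 1) z)"
    using u_init by (intro choice) blast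
  then obtain K' where K': "\<And>n. K' n \<ge> 0" "\<And>n z. u n z \<le> K' n * E (n + 1) z" by blast
  have C: "C \<ge> 1" using D(1,2)[of m2] by auto
  define c where "c = K * C + (\<Sum>n<m. K' n)"
  have "u n z \<le> c * (\<Prod>k. 1 + cmod z / B k)" for n z
  proof (cases "n < m")
    case True
    have "u n z \<le> K' n * E (n + 1) z" by (rule K')
    also have "\<dots> \<le> c * (\<Prod>k. 1 + cmod z / B k)"
    proof (intro mult_mono E_Pi)
      have "K' n \<le> (\<Sum>n<m. K' n)" using True K' by (intro member_le_sum) auto
      then show "K' n \<le> c" using K C by (simp add: c_def add_increasing)
      show "0 \<le> c" using K C K' by (simp add: c_def sum_nonneg)
    qed (use E_pos in \<open>auto intro: less_imp_le\<close>)
    finally show ?thesis .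
  next
    case False
    then have "u n z \<le> (K * D n) * E (n + 1) z" using u_late[of n z] by auto
    also have "\<dots> \<le> c * (\<Prod>k. 1 + cmod z / B k)"
    proof (intro mult_mono E_Pi)
      have "K * D n \<le> K * C" using False K D(2)[of n] by (intro mult_left_mono) (auto simp: m_def)
      then show "K * D n \<le> c" using K' by (simp add: c_def add_increasing2 sum_nonneg)
      show "0 \<le> c" using K C K' by (simp add: c_def sum_nonneg)
    qed (use E_pos in \<open>auto intro: less_imp_le\<close>)
    finally show ?thesis .
  qed
  then show ?thesis unfolding u_def by blast
qed

text \<open>As \<open>B n\<close> is nonzero the recurrence runs backwards, and two consecutive
  zeros would propagate down to the initial values.\<close>

lemma nonzero_pair:
  assumes "(\<rho>0, \<rho>1) \<noteq> (0, 0)"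
  shows "R n z \<noteq> 0 \<or> R (n + 1) z \<noteq> 0"
proof (induction n)
  case 0
  show ?case using assms by (auto simp: R_0 R_1[simplified])
next
  case (Suc n)
  show ?case
  proof (rule ccontr)
    assume "\<not> ?thesis"
    then have *: "R (n + 1) z = 0" "R (n + 2) z = 0" by auto
    with backward_bound[of n z] have "B n * cmod (R n z) \<le> 0" by simp
    then have "R n z = 0" using B_pos[of n] by (simp add: mult_le_0_iff)
    with * Suc show False by simp
  qed
qed

text \<open>Read backwards, the recursion says that the maximum \<open>M\<close> of two weighted
  neighbours cannot decay: \<open>M n * D (n + 1)\<close> is eventually nondecreasing. It starts
  positive and \<open>D\<close> is bounded, so \<open>M\<close> stays away from zero.\<close>

theorem lower_bound:
  assumes nz: "(\<rho>0, \<rho>1) \<noteq> (0, 0)"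
  shows "\<exists>K>0. \<forall>n. max (cmod (R (n + 1) z)) (cmod (R (n + 2) z)) \<ge> K / sqrt (B (n + 2))"
proof -
  define v where "v n = sqrt (B (n + 1)) * cmod (R (n + 1) z)" for n
  define M where "M n = max (v n) (v (n + 1))" for n
  have v0: "v n \<ge> 0" for n by (simp add: v_def)
  have M_pos: "M n > 0" for n
    using nonzero_pair[OF nz, of "n + 1" z] B_pos[of "n + 1"] B_pos[of "n + 2"]
    by (auto simp: M_def v_def less_max_iff_disj)
  obtain m1 where m1: "\<And>m. m \<ge> m1 \<Longrightarrow> B m \<le> B (m + 1)" by (rule eventually_increasing) blast
  \<comment> \<open>The index is one lower than in the upper bound, so that
    \<open>\<alpha> (n + 1)\<close> accompanies \<open>kap (n + 1)\<close>.\<close>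
  define \<alpha> where "\<alpha> n = (cmod z + \<bar>A n\<bar>) / sqrt (B (n + 1) * B n)" for n
  have \<alpha>0: "\<alpha> n \<ge> 0" for n by (simp add: \<alpha>_def)
  have "summable (\<lambda>n. \<alpha> (n + 1))"
  proof (rule summable_comparison_test'[OF summable_mult[OF summable_coeffs, of "1 + cmod z"]])
    fix n
    have "cmod z + \<bar>A (n + 1)\<bar> \<le> (1 + cmod z) * (1 + \<bar>A (n + 1)\<bar>)"
      by (simp add: algebra_simps)
    then have "(cmod z + \<bar>A (n + 1)\<bar>) / sqrt (B (n + 2) * B (n + 1))
        \<le> (1 + cmod z) * (1 + \<bar>A (n + 1)\<bar>) / sqrt (B (n + 2) * B (n + 1))"
      by (intro divide_right_mono) auto
    then show "norm (\<alpha> (n + 1)) \<le> (1 + cmod z) * ((1 + \<bar>A (n + 1)\<bar>) / sqrt (B (n + 2) * B (n + 1)))"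
      using \<alpha>0[of "n + 1"] by (simp add: \<alpha>_def)
  qed
  then have "summable \<alpha>" using summable_iff_shift[of \<alpha> 1] by simp
  then obtain D C m2 where D: "\<And>n. n \<ge> m2 \<Longrightarrow> 1 \<le> D n" "\<And>n. n \<ge> m2 \<Longrightarrow> D n \<le> C"
    "\<And>n. n \<ge> m2 \<Longrightarrow> D n \<le> D (n + 1)" "\<And>n. n \<ge> m2 \<Longrightarrow> (\<alpha> n + kap n) * D n \<le> D (n + 1)"
    using kap_plus_summable_majorant \<alpha>0 by metis
  define m where "m = max m1 m2"
  have M_step: "M n * D (n + 1) \<le> M (n + 1) * D (n + 2)" if n: "n \<ge> m2" for n
  proof -
    have Dn: "0 \<le> D (n + 1)" "0 \<le> D (n + 2)" using D(1)[of "n + 1"] D(1)[of "n + 2"] n by auto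
    have "v n \<le> \<alpha> (n + 1) * v (n + 1) + kap (n + 1) * v (n + 2)"
      using normalized_backward[of n z] by (simp add: v_def \<alpha>_def numeral_eq_Suc)
    also have "\<dots> \<le> \<alpha> (n + 1) * M (n + 1) + kap (n + 1) * M (n + 1)"
      using \<alpha>0 by (intro add_mono mult_left_mono) (auto simp: M_def)
    finally have "v n * D (n + 1) \<le> (\<alpha> (n + 1) * M (n + 1) + kap (n + 1) * M (n + 1)) * D (n + 1)"
      using Dn by (intro mult_right_mono)
    also have "\<dots> = M (n + 1) * ((\<alpha> (n + 1) + kap (n + 1)) * D (n + 1))" by (simp add: algebra_simps)
    also have "\<dots> \<le> M (n + 1) * D (n + 2)"
      using D(4)[of "n + 1"] n M_pos[of "n + 1"] by (intro mult_left_mono) auto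
    finally have 1: "v n * D (n + 1) \<le> M (n + 1) * D (n + 2)" .
    have 2: "v (n + 1) * D (n + 1) \<le> M (n + 1) * D (n + 2)"
      using D(3)[of "n + 1"] n Dn v0 M_pos[of "n + 1"] by (intro mult_mono) (auto simp: M_def)
    show ?thesis using 1 2 by (auto simp: M_def max_def)
  qed
  have late: "M m * D (m + 1) \<le> M n * D (n + 1)" if "n \<ge> m" for n
    using that
  proof (induction n rule: dec_induct)
    case (step n)
    with M_step[of n] show ?case
      by (auto simp: m_def)
  qed simp
  have C: "C \<ge> 1" using D(1,2)[of m2] by auto
  \<comment> \<open>Both values carry the weight of the later one, as in the claim. From
    \<open>m\<close> on, monotonicity of \<open>B\<close> gives \<open>M n \<le> g n\<close>; below
    \<open>m\<close> the positivity of finitely many values suffices.\<close>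
  define g where "g n = sqrt (B (n + 2)) * max (cmod (R (n + 1) z)) (cmod (R (n + 2) z))" for n
  have g_pos: "g n > 0" for n
    using nonzero_pair[OF nz, of "n + 1" z] B_pos[of "n + 2"] by (auto simp: g_def less_max_iff_disj)
  have g_late: "M m / C \<le> g n" if n: "n \<ge> m" for n
  proof -
    have "M m \<le> M m * D (m + 1)"
      using D(1)[of "m + 1"] M_pos[of m] by (simp add: m_def mult_le_cancel_left1)
    also have "\<dots> \<le> M n * D (n + 1)" by (rule late[OF n])
    also have "\<dots> \<le> M n * C" using D(2)[of "n + 1"] n M_pos[of n] by (intro mult_left_mono) (auto simp: m_def)
    also have "M n \<le> g n"
    proof -
      have "v n \<le> sqrt (B (n + 2)) * cmod (R (n + 1) z)"
        unfolding v_def using m1[of "n + 1"] n by (intro mult_right_mono) (auto simp: m_def)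
      also have "\<dots> \<le> g n" unfolding g_def by (intro mult_left_mono) auto
      finally have "v n \<le> g n" .
      moreover have "v (n + 1) \<le> g n" unfolding g_def v_def by (auto intro!: mult_left_mono)
      ultimately show ?thesis by (simp add: M_def)
    qed
    finally show ?thesis using C by (simp add: field_simps)
  qed
  define K where "K = Min (insert (M m / C) (g ` {..<m}))"
  have "K > 0" unfolding K_def using g_pos M_pos[of m] C by (subst Min_gr_iff) auto
  moreover have "K / sqrt (B (n + 2)) \<le> max (cmod (R (n + 1) z)) (cmod (R (n + 2) z))" for n
  proof -
    have "K \<le> g n"
    proof (cases "n < m")
      case True
      then show ?thesis unfolding K_def by (intro Min_le) auto
    next
      case False
      have "K \<le> M m / C" unfolding K_def by (intro Min_le) auto
      with g_late[of n] False show ?thesis by simp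
    qed
    then show ?thesis using B_pos[of "n + 2"] by (simp add: g_def field_simps)
  qed
  ultimately show ?thesis by blast
qed

section \<open>Bounds for squared moduli\<close>

lemma square_upper_bound: "\<exists>C>0. \<forall>n. (cmod (R (n + 1) z))\<^sup>2 \<le> C / B n"
proof -
  obtain c where c: "\<And>n. sqrt (B n) * cmod (R (n + 1) z) \<le> c * (\<Prod>k. 1 + cmod z / B k)"
    using upper_bound by blast
  define e where "e = c * (\<Prod>k. 1 + cmod z / B k)"
  \<comment> \<open>The summand 1 keeps the constant positive even if \<open>e\<close> is 0.\<close>
  have "(cmod (R (n + 1) z))\<^sup>2 \<le> (e\<^sup>2 + 1) / B n" for n
  proof -
    have "(sqrt (B n) * cmod (R (n + 1) z))\<^sup>2 \<le> e\<^sup>2"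
      using c[of n] by (intro power_mono) (auto simp: e_def)
    then show ?thesis using B_pos[of n] by (simp add: power_mult_distrib field_simps)
  qed
  then show ?thesis by (intro exI[of _ "e\<^sup>2 + 1"]) (auto intro: add_nonneg_pos)
qed

lemma square_sum_bounds:
  assumes nz: "(\<rho>0, \<rho>1) \<noteq> (0, 0)"
  shows "\<exists>K>0. \<exists>L>0. \<forall>n.
    K / B (n + 2) \<le> (cmod (R (n + 1) z))\<^sup>2 + (cmod (R (n + 2) z))\<^sup>2 \<and>
    (cmod (R (n + 1) z))\<^sup>2 + (cmod (R (n + 2) z))\<^sup>2 \<le> L / B n"
proof -
  obtain C where C: "C > 0" "\<And>n. (cmod (R (n + 1) z))\<^sup>2 \<le> C / B n"
    using square_upper_bound by blast
  obtain K where K: "K > 0" "\<And>n. max (cmod (R (n + 1) z)) (cmod (R (n + 2) z)) \<ge> K / sqrt (B (n + 2))"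
    using lower_bound[OF nz] by blast
  obtain c where c: "c > 0" "\<And>n. c * B n \<le> B (n + 1)" by (rule ratio_bounded_below) blast
  have "K\<^sup>2 / B (n + 2) \<le> (cmod (R (n + 1) z))\<^sup>2 + (cmod (R (n + 2) z))\<^sup>2" for n
  proof -
    have "K\<^sup>2 / B (n + 2) = (K / sqrt (B (n + 2)))\<^sup>2" by (simp add: power_divide)
    also have "\<dots> \<le> (max (cmod (R (n + 1) z)) (cmod (R (n + 2) z)))\<^sup>2"
      using K B_pos by (intro power_mono) auto
    also have "\<dots> \<le> (cmod (R (n + 1) z))\<^sup>2 + (cmod (R (n + 2) z))\<^sup>2" by (simp add: max_def)
    finally show ?thesis .
  qed
  moreover have "(cmod (R (n + 1) z))\<^sup>2 + (cmod (R (n + 2) z))\<^sup>2 \<le> (C + C / c) / B n" for n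
  proof -
    have "(cmod (R (n + 2) z))\<^sup>2 \<le> C / B (n + 1)" using C(2)[of "n + 1"] by simp
    also have "\<dots> \<le> C / (c * B n)" using C c B_pos by (intro divide_left_mono) auto
    finally show ?thesis using C(2)[of n] by (simp add: add_divide_distrib)
  qed
  moreover have "K\<^sup>2 > 0" "C + C / c > 0" using K C c by (auto intro: add_pos_pos)
  ultimately show ?thesis by blast
qed

end

section \<open>Quadrature with a prescribed node\<close>

text \<open>A Hilbert-Schmidt norm computation: the Gram matrix \<open>D\<close> of the columns has
  trace n and squared norm n, so its squared distance from the identity is n - 2n + n = 0.\<close>

lemma orthonormal_rows_imp_columns:
  fixes U :: "nat \<Rightarrow> nat \<Rightarrow> real"
  assumes "\<And>i j. i < n \<Longrightarrow> j < n \<Longrightarrow> (\<Sum>k<n. U i k * U j k) = (if i = j then 1 else 0)"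
    and "i < n" "j < n"
  shows "(\<Sum>k<n. U k i * U k j) = (if i = j then 1 else 0)"
proof -
  define D where "D j k = (\<Sum>i<n. U i j * U i k)" for j k
  define \<delta> where "\<delta> j k = (if j = k then 1 else 0 :: real)" for j k :: nat
  have trace: "(\<Sum>j<n. D j j) = real n"
  proof -
    have "(\<Sum>j<n. D j j) = (\<Sum>i<n. \<Sum>j<n. U i j * U i j)"
      unfolding D_def by (rule sum.swap)
    also have "\<dots> = (\<Sum>i<n. 1)" using assms(1) by (intro sum.cong refl) auto
    finally show ?thesis by simp
  qed
  have hilbert_schmidt: "(\<Sum>j<n. \<Sum>k<n. D j k * D j k) = real n"
  proof -
    have "(\<Sum>j<n. \<Sum>k<n. D j k * D j k)
        = (\<Sum>j<n. \<Sum>k<n. \<Sum>i<n. \<Sum>l<n. (U i j * U l j) * (U i k * U l k))"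
      by (simp add: D_def sum_product mult_ac)
    also have "\<dots> = (\<Sum>j<n. \<Sum>i<n. \<Sum>k<n. \<Sum>l<n. (U i j * U l j) * (U i k * U l k))"
      by (intro sum.cong refl sum.swap)
    also have "\<dots> = (\<Sum>j<n. \<Sum>i<n. \<Sum>l<n. \<Sum>k<n. (U i j * U l j) * (U i k * U l k))"
      by (intro sum.cong refl sum.swap)
    also have "\<dots> = (\<Sum>j<n. \<Sum>i<n. \<Sum>l<n. (U i j * U l j) * \<delta> i l)"
      using assms(1) by (intro sum.cong refl) (simp add: \<delta>_def flip: sum_distrib_left)
    also have "\<dots> = (\<Sum>j<n. D j j)"
      by (intro sum.cong refl) (simp add: D_def \<delta>_def if_distrib cong: if_cong)
    finally show ?thesis by (simp add: trace)
  qed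
  have "(\<Sum>j<n. \<Sum>k<n. (D j k - \<delta> j k)\<^sup>2)
      = (\<Sum>j<n. \<Sum>k<n. D j k * D j k) - 2 * (\<Sum>j<n. \<Sum>k<n. D j k * \<delta> j k) + (\<Sum>j<n. \<Sum>k<n. \<delta> j k * \<delta> j k)"
    by (simp add: power2_eq_square algebra_simps sum.distrib sum_subtractf sum_distrib_left)
  also have "\<dots> = 0"
    by (simp add: hilbert_schmidt \<delta>_def if_distrib trace cong: if_cong)
  finally have "(\<Sum>j<n. \<Sum>k<n. (D j k - \<delta> j k)\<^sup>2) = 0" .
  then have "\<forall>j\<in>{..<n}. (\<Sum>k<n. (D j k - \<delta> j k)\<^sup>2) = 0"
    by (subst (asm) sum_nonneg_eq_0_iff) (auto intro: sum_nonneg)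
  then have "(\<Sum>k<n. (D i k - \<delta> i k)\<^sup>2) = 0" using assms(2) by auto
  then have "\<forall>k\<in>{..<n}. (D i k - \<delta> i k)\<^sup>2 = 0"
    by (subst (asm) sum_nonneg_eq_0_iff) auto
  then have "(D i j - \<delta> i j)\<^sup>2 = 0" using assms(3) by auto
  then show ?thesis by (simp add: D_def \<delta>_def)
qed

lemma card_roots_rsquarefree:
  fixes p :: "complex poly"
  assumes "rsquarefree p"
  shows "card {z. poly p z = 0} = degree p"
proof -
  have p0: "p \<noteq> 0" using assms by (simp add: rsquarefree_def)
  have "degree p = degree (smult (lead_coeff p) (\<Prod>z|poly p z = 0. [:-z, 1:]))"
    by (simp only: complex_poly_decompose_rsquarefree[OF assms])
  also have "\<dots> = degree (\<Prod>z|poly p z = 0. [:-z, 1:])" using p0 by simp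
  also have "\<dots> = (\<Sum>z|poly p z = 0. degree [:-z, 1:])" by (intro degree_prod_sum_eq) auto
  finally show ?thesis by simp
qed

lemma cpoly_of_real [simp]: "cpoly p (of_real x) = of_real (poly p x)"
  unfolding cpoly_def by (induction p) (auto simp: map_poly_pCons)

lemma cpoly_cnj: "cpoly p (cnj z) = cnj (cpoly p z)"
  unfolding cpoly_def by (subst poly_cnj_real) (auto simp: coeff_map_poly)

text \<open>\<open>q n\<close> stands for P_{n-1}; thus \<open>q 0\<close> is the zero
  polynomial.\<close>

locale jacobi_polys =
  fixes A B :: "nat \<Rightarrow> real" and q :: "nat \<Rightarrow> real poly"
  assumes B_pos: "B n > 0"
    and q_0: "q 0 = 0" and q_1: "q 1 = 1"
    and degree_q: "degree (q (n + 1)) = n"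
    and rec: "z * cpoly (q (n + 1)) z = of_real (B (n + 1)) * cpoly (q (n + 2)) z
      + of_real (A n) * cpoly (q (n + 1)) z + of_real (B n) * cpoly (q n) z"
begin

text \<open>The Christoffel-Darboux kernel of P_0, ..., P_{N-1}. It is bilinear, not Hermitian, and
  so a polynomial in both arguments; positivity is recovered by taking w = cnj z.\<close>

definition kern :: "nat \<Rightarrow> complex \<Rightarrow> complex \<Rightarrow> complex" where
  "kern N z w = (\<Sum>k<N. cpoly (q (k + 1)) z * cpoly (q (k + 1)) w)"

lemma christoffel_darboux:
  "(z - w) * kern N z w = of_real (B N) * (cpoly (q (N + 1)) z * cpoly (q N) w - cpoly (q N) z * cpoly (q (N + 1)) w)"
proof (induction N)
  case 0
  show ?case by (simp add: kern_def q_0 cpoly_def)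
next
  case (Suc N)
  have kern_Suc: "kern (Suc N) z w = kern N z w + cpoly (q (N + 1)) z * cpoly (q (N + 1)) w"
    by (simp add: kern_def)
  have "(z - w) * kern (Suc N) z w = (z - w) * kern N z w
      + (z * cpoly (q (N + 1)) z) * cpoly (q (N + 1)) w - cpoly (q (N + 1)) z * (w * cpoly (q (N + 1)) w)"
    unfolding kern_Suc by algebra
  also have "\<dots> = of_real (B (Suc N)) * (cpoly (q (Suc N + 1)) z * cpoly (q (Suc N)) w
      - cpoly (q (Suc N)) z * cpoly (q (Suc N + 1)) w)"
    by (simp only: Suc.IH rec) (simp add: algebra_simps)
  finally show ?case .
qed

text \<open>Obtained by differentiating the Christoffel-Darboux formula, as an identity of
  polynomials in z, at z = w.\<close>

lemma christoffel_darboux_confluent: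
  fixes N w
  defines "c n \<equiv> map_poly of_real (q n) :: complex poly"
  shows "kern N w w = of_real (B N) *
    (poly (pderiv (c (N + 1))) w * cpoly (q N) w - poly (pderiv (c N)) w * cpoly (q (N + 1)) w)"
proof -
  define Kp where "Kp = (\<Sum>k<N. smult (cpoly (q (k + 1)) w) (c (k + 1)))"
  have Kp: "poly Kp z = kern N z w" for z
    by (simp add: Kp_def kern_def c_def cpoly_def poly_sum mult.commute)
  have "[:-w, 1:] * Kp = smult (of_real (B N)) (smult (cpoly (q N) w) (c (N + 1)) - smult (cpoly (q (N + 1)) w) (c N))"
    (is "?l = ?r")
  proof (rule poly_eq_poly_eq_iff[THEN iffD1], rule ext)
    fix z
    have "poly ?l z = (z - w) * kern N z w" by (simp add: Kp algebra_simps)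
    also have "\<dots> = poly ?r z"
      unfolding christoffel_darboux by (simp add: c_def cpoly_def algebra_simps)
    finally show "poly ?l z = poly ?r z" .
  qed
  then have "poly (pderiv ?l) w = poly (pderiv ?r) w" by simp
  then show ?thesis
    by (simp add: pderiv_mult pderiv_diff pderiv_smult pderiv_pCons Kp algebra_simps)
qed

lemma kern_cnj_nonzero: "N \<ge> 1 \<Longrightarrow> kern N z (cnj z) \<noteq> 0"
proof -
  assume N: "N \<ge> 1"
  have "kern N z (cnj z) = of_real (\<Sum>k<N. (cmod (cpoly (q (k + 1)) z))\<^sup>2)"
    unfolding kern_def cpoly_cnj of_real_sum
    by (intro sum.cong refl) (simp add: complex_norm_square flip: of_real_power)
  moreover have "(\<Sum>k<N. (cmod (cpoly (q (k + 1)) z))\<^sup>2) \<ge> (cmod (cpoly (q (0 + 1)) z))\<^sup>2"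
    using N by (intro member_le_sum) auto
  moreover have "cmod (cpoly (q (0 + 1)) z) = 1" using q_1 by (simp add: cpoly_def)
  ultimately show ?thesis by (simp del: of_real_sum)
qed

text \<open>The kernel on the real diagonal. Its reciprocal, the Christoffel function, is the
  quadrature weight.\<close>

definition rkern :: "nat \<Rightarrow> real \<Rightarrow> real" where
  "rkern N x = (\<Sum>k<N. (poly (q (k + 1)) x)\<^sup>2)"

lemma rkern_pos: "N \<ge> 1 \<Longrightarrow> rkern N x > 0"
proof -
  assume N: "N \<ge> 1"
  have "(poly (q (0 + 1)) x)\<^sup>2 \<le> rkern N x"
    unfolding rkern_def using N by (intro member_le_sum) auto
  then show ?thesis using q_1 by simp
qed

text \<open>The nodes are the zeros of the quasi-orthogonal polynomial vanishing at \<open>x0\<close>. By the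
  Christoffel-Darboux formula the vectors of the values of the first \<open>N\<close> orthonormal
  polynomials at distinct zeros are orthogonal, which gives reality and simplicity of the zeros;
  having \<open>N\<close> of them, orthogonality of the rows turns into orthogonality of the columns.\<close>

lemma quadrature_with_node:
  assumes N: "N \<ge> 1" and x0: "poly (q N) x0 \<noteq> 0"
  obtains X where "finite X" "x0 \<in> X"
    "\<And>j k. j < N \<Longrightarrow> k < N \<Longrightarrow>
       (\<Sum>x\<in>X. poly (q (j + 1)) x * poly (q (k + 1)) x / rkern N x) = (if j = k then 1 else 0)"
proof -
  define c where "c n = (map_poly of_real (q n) :: complex poly)" for n
  have c: "poly (c n) z = cpoly (q n) z" for n z by (simp add: c_def cpoly_def)
  define s where "s = complex_of_real (poly (q N) x0)"
  define s' where "s' = complex_of_real (poly (q (N + 1)) x0)"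
  have s0: "s \<noteq> 0" using x0 by (simp add: s_def)
  \<comment> \<open>Up to the factors \<open>s\<close> and \<open>s'\<close> a combination of P_N
    and P_{N-1}. The leading one, \<open>s\<close>, is P_{N-1}(x0), which is nonzero by assumption,
    so the degree is exactly N.\<close>
  define F where "F = smult s (c (N + 1)) - smult s' (c N)"
  have root_iff: "poly F z = 0 \<longleftrightarrow> s * cpoly (q (N + 1)) z = s' * cpoly (q N) z" for z
    by (auto simp: F_def c)
  have deg_c: "degree (c n) = degree (q n)" for n
    unfolding c_def by (intro degree_map_poly) auto
  have "degree (q N) < N" using degree_q[of "N - 1"] N by simp
  then have "degree F = N"
    unfolding F_def diff_conv_add_uminus using s0 degree_q[of N]
    by (subst degree_add_eq_left) (auto simp: deg_c)
  \<comment> \<open>At every zero of \<open>F\<close> the values of P_N and P_{N-1} are proportional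
    to \<open>s'\<close> and \<open>s\<close>, so the determinant in the Christoffel-Darboux formula
    vanishes.\<close>
  have orth: "(z - w) * kern N z w = 0" if "poly F z = 0" "poly F w = 0" for z w
  proof -
    have "s * (cpoly (q (N + 1)) z * cpoly (q N) w - cpoly (q N) z * cpoly (q (N + 1)) w)
        = (s * cpoly (q (N + 1)) z) * cpoly (q N) w - cpoly (q N) z * (s * cpoly (q (N + 1)) w)"
      by (simp add: algebra_simps)
    also have "\<dots> = 0" using that by (simp add: root_iff)
    finally show ?thesis using s0 by (simp add: christoffel_darboux)
  qed
  \<comment> \<open>With z also cnj z is a zero, and the kernel at this pair is a positive sum of
    squared moduli.\<close>
  have real_root: "z \<in> \<real>" if "poly F z = 0" for z
  proof -
    have "poly F (cnj z) = cnj (poly F z)"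
      by (simp add: F_def c cpoly_cnj s_def s'_def)
    with that orth[of z "cnj z"] kern_cnj_nonzero[OF N, of z] have "z = cnj z" by simp
    then show ?thesis by (simp add: Reals_cnj_iff)
  qed
  have kern_real: "kern N (of_real x) (of_real x) = of_real (rkern N x)" for x
    by (simp add: kern_def rkern_def power2_eq_square)
  \<comment> \<open>At a double zero, which is real, the confluent formula would make the kernel
    vanish, although it is a sum of squares containing P_0^2 = 1.\<close>
  have "rsquarefree F"
    unfolding rsquarefree_roots
  proof (intro allI notI, elim conjE)
    fix z assume z: "poly F z = 0" "poly (pderiv F) z = 0"
    have 1: "s * poly (pderiv (c (N + 1))) z = s' * poly (pderiv (c N)) z"
      using z by (simp add: F_def pderiv_diff pderiv_smult)
    have 2: "s * cpoly (q (N + 1)) z = s' * cpoly (q N) z" using z root_iff by blast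
    have "s * (poly (pderiv (c (N + 1))) z * cpoly (q N) z - poly (pderiv (c N)) z * cpoly (q (N + 1)) z)
       = (s * poly (pderiv (c (N + 1))) z) * cpoly (q N) z - poly (pderiv (c N)) z * (s * cpoly (q (N + 1)) z)"
      by (simp add: algebra_simps)
    also have "\<dots> = 0" unfolding 1 2 by simp
    finally have "kern N z z = 0" using s0 by (simp add: christoffel_darboux_confluent c_def)
    moreover have "z = cnj z" using real_root[OF z(1)] by (simp add: Reals_cnj_iff)
    ultimately show False using kern_cnj_nonzero[OF N, of z] by simp
  qed
  then have card_roots: "card {z. poly F z = 0} = N"
    using card_roots_rsquarefree \<open>degree F = N\<close> by simp
  then have fin_roots: "finite {z. poly F z = 0}" using N card_ge_0_finite by force
  define X where "X = Re ` {z. poly F z = 0}"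
  have X_root: "poly F (of_real x) = 0" if "x \<in> X" for x
    using that real_root by (auto simp: X_def of_real_Re)
  have inj: "inj_on Re {z. poly F z = 0}"
    using real_root by (auto intro!: inj_onI) (metis of_real_Re)
  have X: "finite X" "card X = N"
    unfolding X_def using fin_roots card_roots by (auto simp: card_image[OF inj])
  have "poly F (of_real x0) = 0" by (simp add: root_iff s_def s'_def)
  then have "x0 \<in> X" unfolding X_def by force
  obtain f where f: "bij_betw f {..<N} X"
    using ex_bij_betw_nat_finite[OF X(1)] X(2) by (auto simp: lessThan_atLeast0)
  have f_inj: "f i = f j \<longleftrightarrow> i = j" if "i < N" "j < N" for i j
    using f that by (auto simp: bij_betw_def inj_on_def)
  have f_X: "f i \<in> X" if "i < N" for i using f that by (auto simp: bij_betw_def)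
  \<comment> \<open>Rows belong to nodes, columns to polynomials. Orthonormal rows come from the
    kernel; orthonormal columns are the quadrature identities.\<close>
  define U where "U i k = poly (q (k + 1)) (f i) / sqrt (rkern N (f i))" for i k
  have rows: "(\<Sum>k<N. U i k * U j k) = (if i = j then 1 else 0)" if ij: "i < N" "j < N" for i j
  proof (cases "i = j")
    case True
    have "(\<Sum>k<N. U i k * U i k) = rkern N (f i) / rkern N (f i)"
      unfolding U_def using rkern_pos[OF N, of "f i"]
      by (simp add: rkern_def power2_eq_square flip: sum_divide_distrib)
    then show ?thesis using True rkern_pos[OF N, of "f i"] by simp
  next
    case False
    have "kern N (of_real (f i)) (of_real (f j)) = 0"
      using orth[OF X_root[OF f_X[OF ij(1)]] X_root[OF f_X[OF ij(2)]]] f_inj[OF ij] False by simp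
    then have "complex_of_real (\<Sum>k<N. poly (q (k + 1)) (f i) * poly (q (k + 1)) (f j)) = 0"
      by (simp add: kern_def)
    then have "(\<Sum>k<N. poly (q (k + 1)) (f i) * poly (q (k + 1)) (f j)) = 0"
      by (simp only: of_real_eq_0_iff)
    moreover have "(\<Sum>k<N. U i k * U j k) = (\<Sum>k<N. poly (q (k + 1)) (f i) * poly (q (k + 1)) (f j))
        / (sqrt (rkern N (f i)) * sqrt (rkern N (f j)))"
      by (simp add: U_def sum_divide_distrib)
    ultimately show ?thesis using False by simp
  qed
  show ?thesis
  proof (rule that[OF X(1) \<open>x0 \<in> X\<close>])
    fix j k assume jk: "j < N" "k < N"
    have "(\<Sum>x\<in>X. poly (q (j + 1)) x * poly (q (k + 1)) x / rkern N x)
       = (\<Sum>i<N. poly (q (j + 1)) (f i) * poly (q (k + 1)) (f i) / rkern N (f i))"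
      by (rule sum.reindex_bij_betw[OF f, symmetric])
    also have "\<dots> = (\<Sum>i<N. U i j * U i k)"
      using rkern_pos[OF N] by (intro sum.cong refl) (simp add: U_def less_imp_le)
    also have "\<dots> = (if j = k then 1 else 0)"
      by (rule orthonormal_rows_imp_columns[OF rows jk]) auto
    finally show "(\<Sum>x\<in>X. poly (q (j + 1)) x * poly (q (k + 1)) x / rkern N x) = (if j = k then 1 else 0)" .
  qed
qed

section \<open>Exactness of the quadrature on monomials\<close>

lemma q_spans:
  "degree f < N \<Longrightarrow> \<exists>c. f = (\<Sum>k<N. smult (c k) (q (k + 1)))"
proof (induction N arbitrary: f)
  case (Suc N)
  have q_nz: "q (N + 1) \<noteq> 0" using degree_q[of N] q_1 by (cases N) auto
  define t where "t = coeff f N / lead_coeff (q (N + 1))"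
  define g where "g = f - smult t (q (N + 1))"
  have "coeff (q (N + 1)) N \<noteq> 0" using degree_q[of N] q_nz by (metis leading_coeff_0_iff)
  then have cg: "coeff g N = 0" using degree_q[of N] by (simp add: g_def t_def)
  have dg: "degree g \<le> N" unfolding g_def
    using Suc.prems degree_q[of N] by (intro degree_diff_le) auto
  \<comment> \<open>The zero polynomial also has degree 0, so for \<open>N = 0\<close> the vanishing
    coefficient does not lower the degree but shows that \<open>g\<close> is 0.\<close>
  show ?case
  proof (cases "N = 0")
    case True
    then have "g = 0" using dg cg by (metis le_zero_eq leading_coeff_0_iff)
    then show ?thesis using True by (intro exI[of _ "\<lambda>_. t"]) (simp add: g_def)
  next
    case False
    then have "degree g < N" using dg cg
      by (metis degree_0 gr0I le_neq_implies_less leading_coeff_0_iff)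
    from Suc.IH[OF this] obtain c where c: "g = (\<Sum>k<N. smult (c k) (q (k + 1)))" by blast
    have "f = g + smult t (q (N + 1))" by (simp add: g_def)
    also have "\<dots> = (\<Sum>k<Suc N. smult ((c(N := t)) k) (q (k + 1)))" by (simp add: c)
    finally show ?thesis by blast
  qed
qed simp

lemma functional_on_products:
  fixes L :: "real poly \<Rightarrow> real"
  assumes add: "\<And>f g. L (f + g) = L f + L g" and smult: "\<And>c f. L (smult c f) = c * L f"
    and orth: "\<And>j k. j < N \<Longrightarrow> k < N \<Longrightarrow> L (q (j + 1) * q (k + 1)) = (if j = k then 1 else 0)"
  shows "L ((\<Sum>k<N. smult (c k) (q (k + 1))) * (\<Sum>k<N. smult (d k) (q (k + 1)))) = (\<Sum>k<N. c k * d k)"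
proof -
  have L0: "L 0 = 0" using smult[of 0 0] by simp
  have L_sum: "L (sum h S) = (\<Sum>x\<in>S. L (h x))" if "finite S" for h :: "nat \<Rightarrow> real poly" and S
    using that by (induction S rule: finite_induct) (simp_all add: L0 add)
  have "L ((\<Sum>k<N. smult (c k) (q (k + 1))) * (\<Sum>k<N. smult (d k) (q (k + 1))))
      = (\<Sum>j<N. \<Sum>k<N. c j * (d k * L (q (j + 1) * q (k + 1))))"
    by (simp add: sum_product L_sum smult mult_ac)
  also have "\<dots> = (\<Sum>j<N. \<Sum>k<N. if k = j then c j * d k else 0)"
    using orth by (intro sum.cong refl) auto
  also have "\<dots> = (\<Sum>k<N. c k * d k)" by (intro sum.cong refl) (simp add: sum.delta)
  finally show ?thesis .
qed

text \<open>A monomial of degree at most 2N - 2 is a product of two of degree below N. Both factors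
  expand in \<open>q 1\<close>, ..., \<open>q N\<close>, so the orthonormality relations determine
  the value.\<close>

lemma functionals_agree:
  fixes L1 L2 :: "real poly \<Rightarrow> real"
  assumes "\<And>f g. L1 (f + g) = L1 f + L1 g" "\<And>c f. L1 (smult c f) = c * L1 f"
    and "\<And>j k. j < N \<Longrightarrow> k < N \<Longrightarrow> L1 (q (j + 1) * q (k + 1)) = (if j = k then 1 else 0)"
    and "\<And>f g. L2 (f + g) = L2 f + L2 g" "\<And>c f. L2 (smult c f) = c * L2 f"
    and "\<And>j k. j < N \<Longrightarrow> k < N \<Longrightarrow> L2 (q (j + 1) * q (k + 1)) = (if j = k then 1 else 0)"
    and n: "n + 2 \<le> 2 * N"
  shows "L1 (monom 1 n) = L2 (monom 1 n)"
proof -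
  have "n div 2 < N" "n - n div 2 < N" using n by auto
  then have "degree (monom (1::real) (n div 2)) < N" "degree (monom (1::real) (n - n div 2)) < N"
    by (auto simp: degree_monom_eq)
  then obtain c d where cd: "monom (1::real) (n div 2) = (\<Sum>k<N. smult (c k) (q (k + 1)))"
    "monom (1::real) (n - n div 2) = (\<Sum>k<N. smult (d k) (q (k + 1)))"
    using q_spans by meson
  have "monom (1::real) n = monom 1 (n div 2) * monom 1 (n - n div 2)" by (simp add: mult_monom)
  then show ?thesis
    unfolding cd using functional_on_products[of L1 N c d] functional_on_products[of L2 N c d] assms(1-6)
    by simp
qed

end

section \<open>Limits of measures with converging moments\<close>

lemma real_distribution_pmf: "real_distribution (distr (measure_pmf p) borel id)" for p :: "real pmf"
  by (intro prob_space.real_distribution_distr) (auto simp: measure_pmf.prob_space_axioms)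

lemma tight_of_second_moment:
  fixes M :: "nat \<Rightarrow> real measure"
  assumes rd: "\<And>n. real_distribution (M n)"
    and int: "\<And>n. integrable (M n) (\<lambda>x. x\<^sup>2)" and mom: "\<And>n. (\<integral>x. x\<^sup>2 \<partial>M n) \<le> v"
  shows "tight M"
  unfolding tight_def
proof (intro conjI allI impI rd)
  fix \<epsilon> :: real assume \<epsilon>: "\<epsilon> > 0"
  \<comment> \<open>Chebyshev's inequality will be applied at radius \<open>r\<close>. The summand 1
    makes the resulting estimate strict and keeps \<open>r\<close> positive when \<open>v\<close> is
    0.\<close>
  define r where "r = sqrt (\<bar>v\<bar> / \<epsilon>) + 1"
  have r: "r > 0" unfolding r_def using \<epsilon> by (auto intro: add_nonneg_pos)
  have "\<bar>v\<bar> / \<epsilon> < r\<^sup>2"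
  proof -
    have "\<bar>v\<bar> / \<epsilon> = (sqrt (\<bar>v\<bar> / \<epsilon>))\<^sup>2" using \<epsilon> by simp
    also have "\<dots> < r\<^sup>2" unfolding r_def using \<epsilon> by (intro power_strict_mono) auto
    finally show ?thesis .
  qed
  then have small: "\<bar>v\<bar> / r\<^sup>2 < \<epsilon>" using \<epsilon> r by (simp add: field_simps)
  have "1 - \<epsilon> < measure (M n) {-r<..r}" for n
  proof -
    interpret real_distribution "M n" by (rule rd)
    have "1 - measure (M n) {-r<..r} = measure (M n) (UNIV - {-r<..r})"
      using prob_compl[of "{-r<..r}"] by (simp add: space_eq_univ)
    also have "\<dots> = (\<integral>x. indicator (UNIV - {-r<..r}) x \<partial>M n)" by simp
    also have "\<dots> \<le> (\<integral>x. x\<^sup>2 / r\<^sup>2 \<partial>M n)"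
    proof (rule integral_mono)
      show "integrable (M n) (indicat_real (UNIV - {-r<..r}))"
        by (intro integrable_real_indicator) (auto simp: emeasure_eq_measure)
      show "integrable (M n) (\<lambda>x. x\<^sup>2 / r\<^sup>2)" using int by simp
      fix x :: real
      show "indicat_real (UNIV - {-r<..r}) x \<le> x\<^sup>2 / r\<^sup>2"
      proof (cases "x \<in> {-r<..r}")
        case False
        then have "r \<le> \<bar>x\<bar>" by auto
        then have "r\<^sup>2 \<le> x\<^sup>2" using r by (metis abs_le_square_iff abs_of_pos)
        then show ?thesis using r by (simp add: indicator_def)
      qed auto
    qed
    also have "\<dots> = (\<integral>x. x\<^sup>2 \<partial>M n) / r\<^sup>2" by simp
    also have "\<dots> \<le> \<bar>v\<bar> / r\<^sup>2" using mom[of n] by (intro divide_right_mono) auto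
    finally show ?thesis using small by simp
  qed
  then show "\<exists>a b. a < b \<and> (\<forall>n. 1 - \<epsilon> < measure (M n) {a<..b})"
    using r by (intro exI[of _ "-r"] exI[of _ r]) auto
qed

text \<open>Weak convergence tests only bounded continuous functions; a power times this trapezoid
  is one, and it agrees with the power on [-r, r].\<close>

definition cutoff :: "real \<Rightarrow> real \<Rightarrow> real" where
  "cutoff r x = max 0 (min 1 (r + 1 - \<bar>x\<bar>))"

lemma cutoff_bounds [simp]: "0 \<le> cutoff r x" "cutoff r x \<le> 1"
  by (auto simp: cutoff_def)

lemma cutoff_eq_1: "\<bar>x\<bar> \<le> r \<Longrightarrow> cutoff r x = 1"
  by (auto simp: cutoff_def)

lemma cutoff_measurable [measurable]: "cutoff r \<in> borel_measurable borel"
  unfolding cutoff_def by measurable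

lemma abs_power_cutoff_le: "\<bar>x ^ k * cutoff r x\<bar> \<le> (\<bar>r\<bar> + 1) ^ k"
proof (cases "\<bar>x\<bar> \<le> \<bar>r\<bar> + 1")
  case True
  have "\<bar>x ^ k * cutoff r x\<bar> = \<bar>x\<bar> ^ k * cutoff r x" by (simp add: abs_mult power_abs)
  also have "\<dots> \<le> (\<bar>r\<bar> + 1) ^ k * 1" using True by (intro mult_mono power_mono) auto
  finally show ?thesis by simp
next
  case False
  then have "cutoff r x = 0" by (auto simp: cutoff_def)
  then show ?thesis by simp
qed

lemma isCont_power_cutoff: "isCont (\<lambda>x. x ^ k * cutoff r x) x"
  unfolding cutoff_def by (intro continuous_intros)

text \<open>Outside [-r, r] the error is at most 1 + x^(2k), and there x^2 / r^2 is at least 1.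
  Hence moments of order 2 and 2k + 2 bound the truncation error.\<close>

lemma power_cutoff_error:
  assumes "r > 0"
  shows "\<bar>x ^ k - x ^ k * cutoff r x\<bar> \<le> (x\<^sup>2 + x ^ (2 * k + 2)) / r\<^sup>2"
proof (cases "\<bar>x\<bar> \<le> r")
  case True
  have "0 \<le> x ^ (2 * k + 2)" by (rule zero_le_even_power) simp
  then show ?thesis using True by (simp add: cutoff_eq_1)
next
  case False
  have "x ^ k - x ^ k * cutoff r x = x ^ k * (1 - cutoff r x)" by (simp add: algebra_simps)
  then have "\<bar>x ^ k - x ^ k * cutoff r x\<bar> = \<bar>x\<bar> ^ k * (1 - cutoff r x)"
    by (simp add: abs_mult power_abs)
  also have "\<dots> \<le> \<bar>x\<bar> ^ k * 1" by (intro mult_left_mono) auto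
  also have "\<dots> \<le> 1 + (\<bar>x\<bar> ^ k)\<^sup>2"
  proof -
    have "0 \<le> (\<bar>x\<bar> ^ k - 1 / 2)\<^sup>2" by simp
    then show ?thesis by (simp add: power2_eq_square algebra_simps)
  qed
  finally have 1: "\<bar>x ^ k - x ^ k * cutoff r x\<bar> \<le> 1 + x ^ (2 * k)"
    by (simp add: power_even_abs flip: power_mult)  (simp add: mult.commute power_even_abs)
  have 2: "1 \<le> x\<^sup>2 / r\<^sup>2"
  proof -
    have "r\<^sup>2 \<le> x\<^sup>2" using False assms by (metis abs_le_square_iff abs_of_pos linear)
    then show ?thesis using assms by simp
  qed
  have "0 \<le> 1 + x ^ (2 * k)" by (simp add: add_nonneg_nonneg)
  from mult_left_mono[OF 2 this] 1
  have "\<bar>x ^ k - x ^ k * cutoff r x\<bar> \<le> (1 + x ^ (2 * k)) * (x\<^sup>2 / r\<^sup>2)" by simp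
  also have "\<dots> = (x\<^sup>2 + x ^ (2 * k + 2)) / r\<^sup>2" by (simp add: field_simps power_add power2_eq_square)
  finally show ?thesis .
qed

lemma cutoff_tendsto: "(\<lambda>n. x ^ k * cutoff (real n) x) \<longlonglongrightarrow> x ^ k"
proof (rule tendsto_eventually)
  obtain N :: nat where "\<bar>x\<bar> \<le> real N" using real_arch_simple by blast
  then show "\<forall>\<^sub>F n in sequentially. x ^ k * cutoff (real n) x = x ^ k"
    by (auto simp: eventually_sequentially intro!: exI[of _ N] simp: cutoff_eq_1)
qed

text \<open>Even moments of the limit are finite by monotone convergence, because truncating an even
  power only lowers its integral; they dominate the odd ones. The values follow because the
  truncation error is uniform along the sequence.\<close>

lemma weak_limit_moments:
  fixes M :: "nat \<Rightarrow> real measure" and s :: "nat \<Rightarrow> real"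
  assumes rd: "\<And>n. real_distribution (M n)" and rd': "real_distribution \<nu>"
    and conv: "weak_conv_m M \<nu>"
    and int: "\<And>n k. integrable (M n) (\<lambda>x. x ^ k)"
    and mom: "\<And>k. \<forall>\<^sub>F n in sequentially. (\<integral>x. x ^ k \<partial>M n) = s k"
  shows "has_moments \<nu> s"
proof -
  interpret \<nu>: real_distribution \<nu> by (rule rd')
  have cint: "integrable N (\<lambda>x. x ^ k * cutoff r x)" if "real_distribution N" for N k r
  proof -
    interpret N: real_distribution N by (rule that)
    show ?thesis by (rule N.integrable_const_bound[where B="(\<bar>r\<bar> + 1) ^ k"])
      (use abs_power_cutoff_le in auto)
  qed
  have clim: "(\<lambda>n. \<integral>x. x ^ k * cutoff r x \<partial>M n) \<longlonglongrightarrow> (\<integral>x. x ^ k * cutoff r x \<partial>\<nu>)" for k r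
    by (rule weak_conv_imp_integral_bdd_continuous_conv[OF rd rd' conv, where B="(\<bar>r\<bar> + 1) ^ k"])
       (use isCont_power_cutoff abs_power_cutoff_le in auto)
  have even_le: "(\<integral>x. x ^ (2 * k) * cutoff r x \<partial>\<nu>) \<le> s (2 * k)" for k r
  proof (rule tendsto_upperbound[OF clim])
    show "\<forall>\<^sub>F n in sequentially. (\<integral>x. x ^ (2 * k) * cutoff r x \<partial>M n) \<le> s (2 * k)"
      using mom[of "2 * k"]
    proof eventually_elim
      case (elim n)
      have "(\<integral>x. x ^ (2 * k) * cutoff r x \<partial>M n) \<le> (\<integral>x. x ^ (2 * k) \<partial>M n)"
        by (intro integral_mono cint rd int) (simp add: mult_left_le)
      with elim show ?case by simp
    qed
  qed simp
  have even_int: "integrable \<nu> (\<lambda>x. x ^ (2 * k))" for k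
  proof (rule integrable_monotone_convergence(1))
    let ?a = "\<lambda>n. \<integral>x. x ^ (2 * k) * cutoff (real n) x \<partial>\<nu>"
    have mono: "cutoff (real m) x \<le> cutoff (real n) x" if "m \<le> n" for m n x
      using that by (auto simp: cutoff_def)
    have "incseq ?a"
      by (intro incseq_SucI integral_mono cint rd' mult_left_mono mono) auto
    moreover have "Bseq ?a"
    proof (rule BseqI')
      fix n show "norm (?a n) \<le> s (2 * k)"
        using even_le[of k "real n"] by (simp add: integral_nonneg_AE)
    qed
    ultimately have "convergent ?a" by (simp add: Bseq_monoseq_convergent incseq_imp_monoseq)
    then show "?a \<longlonglongrightarrow> lim ?a" by (simp add: convergent_LIMSEQ_iff)
    show "integrable \<nu> (\<lambda>x. x ^ (2 * k) * cutoff (real n) x)" for n by (rule cint[OF rd'])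
    show "AE x in \<nu>. mono (\<lambda>n. x ^ (2 * k) * cutoff (real n) x)"
      using mono by (intro AE_I2 monoI mult_left_mono) auto
    show "AE x in \<nu>. (\<lambda>n. x ^ (2 * k) * cutoff (real n) x) \<longlonglongrightarrow> x ^ (2 * k)"
      by (intro AE_I2 cutoff_tendsto)
  qed simp
  have int': "integrable \<nu> (\<lambda>x. x ^ k)" for k
  proof (rule Bochner_Integration.integrable_bound)
    show "integrable \<nu> (\<lambda>x. 1 + x ^ (2 * k))" using even_int[of k] by simp
    show "AE x in \<nu>. norm (x ^ k) \<le> norm (1 + x ^ (2 * k))"
    proof (rule AE_I2)
      fix x :: real
      have "0 \<le> (\<bar>x ^ k\<bar> - 1 / 2)\<^sup>2" by simp
      then have "\<bar>x ^ k\<bar> \<le> 1 + (x ^ k)\<^sup>2" by (simp add: power2_eq_square algebra_simps)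
      then show "norm (x ^ k) \<le> norm (1 + x ^ (2 * k))" by (simp add: mult.commute flip: power_mult)
    qed
  qed simp
  have "(\<integral>x. x ^ k \<partial>\<nu>) = s k" for k
  proof (rule LIMSEQ_unique)
    show "(\<lambda>m. \<integral>x. x ^ k * cutoff (real m) x \<partial>\<nu>) \<longlonglongrightarrow> (\<integral>x. x ^ k \<partial>\<nu>)"
    proof (rule integral_dominated_convergence[where w="\<lambda>x. norm (x ^ k)"])
      show "integrable \<nu> (\<lambda>x. norm (x ^ k))" using int'[of k] by (rule integrable_norm)
      show "AE x in \<nu>. (\<lambda>m. x ^ k * cutoff (real m) x) \<longlonglongrightarrow> x ^ k" by (intro AE_I2 cutoff_tendsto)
      show "AE x in \<nu>. norm (x ^ k * cutoff (real m) x) \<le> norm (x ^ k)" for m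
        by (intro AE_I2) (simp add: abs_mult mult_left_le)
    qed simp_all
    show "(\<lambda>m. \<integral>x. x ^ k * cutoff (real m) x \<partial>\<nu>) \<longlonglongrightarrow> s k"
    proof (rule Lim_null_comparison[THEN LIM_zero_cancel])
      \<comment> \<open>The moments from \<open>power_cutoff_error\<close>. For large
        \<open>n\<close> they are those of \<open>M n\<close>, so the bound does not depend on
        \<open>n\<close> and survives the weak limit.\<close>
      define e where "e = s 2 + s (2 * k + 2)"
      have "\<bar>(\<integral>x. x ^ k * cutoff (real m) x \<partial>\<nu>) - s k\<bar> \<le> e / (real m)\<^sup>2" if m: "m > 0" for m
      proof (rule tendsto_upperbound)
        show "(\<lambda>n. \<bar>(\<integral>x. x ^ k * cutoff (real m) x \<partial>M n) - s k\<bar>)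
            \<longlonglongrightarrow> \<bar>(\<integral>x. x ^ k * cutoff (real m) x \<partial>\<nu>) - s k\<bar>"
          by (intro tendsto_intros clim)
        show "\<forall>\<^sub>F n in sequentially. \<bar>(\<integral>x. x ^ k * cutoff (real m) x \<partial>M n) - s k\<bar> \<le> e / (real m)\<^sup>2"
          using mom[of k] mom[of 2] mom[of "2 * k + 2"]
        proof eventually_elim
          case (elim n)
          have "\<bar>(\<integral>x. x ^ k * cutoff (real m) x \<partial>M n) - s k\<bar>
              = \<bar>\<integral>x. x ^ k - x ^ k * cutoff (real m) x \<partial>M n\<bar>"
            using int cint[OF rd] by (subst Bochner_Integration.integral_diff) (auto simp: elim abs_minus_commute)
          also have "\<dots> \<le> (\<integral>x. \<bar>x ^ k - x ^ k * cutoff (real m) x\<bar> \<partial>M n)" by (rule integral_abs_bound)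
          also have "\<dots> \<le> (\<integral>x. (x\<^sup>2 + x ^ (2 * k + 2)) / (real m)\<^sup>2 \<partial>M n)"
          proof (rule integral_mono)
            show "integrable (M n) (\<lambda>x. \<bar>x ^ k - x ^ k * cutoff (real m) x\<bar>)"
              by (intro integrable_abs Bochner_Integration.integrable_diff int cint rd)
            show "integrable (M n) (\<lambda>x. (x\<^sup>2 + x ^ (2 * k + 2)) / (real m)\<^sup>2)"
              by (intro integrable_divide Bochner_Integration.integrable_add int)
          qed (use m in \<open>intro power_cutoff_error, simp\<close>)
          also have "\<dots> = e / (real m)\<^sup>2"
            using int[of n 2] int[of n "2 * k + 2"] elim by (simp add: e_def)
          finally show ?case .
        qed
      qed simp
      then show "\<forall>\<^sub>F m in sequentially. norm ((\<integral>x. x ^ k * cutoff (real m) x \<partial>\<nu>) - s k) \<le> e / (real m)\<^sup>2"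
        by (auto simp: eventually_sequentially intro!: exI[of _ 1])
      show "(\<lambda>m. e / (real m)\<^sup>2) \<longlonglongrightarrow> 0" by real_asymp
    qed
  qed
  then show ?thesis using int' by (simp add: has_moments_def)
qed

text \<open>Mass on a closed set cannot escape in a weak limit: tent functions of height 1 at
  \<open>x0\<close> dominate the indicator of the point and shrink to it.\<close>

lemma weak_limit_atom:
  fixes M :: "nat \<Rightarrow> real measure"
  assumes rd: "\<And>n. real_distribution (M n)" and rd': "real_distribution \<nu>"
    and conv: "weak_conv_m M \<nu>" and atom: "\<And>n. \<rho> \<le> measure (M n) {x0}"
  shows "\<rho> \<le> measure \<nu> {x0}"
proof -
  interpret \<nu>: real_distribution \<nu> by (rule rd')
  define h where "h m x = max 0 (1 - real m * \<bar>x - x0\<bar>)" for m x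
  have h: "0 \<le> h m x" "h m x \<le> 1" "h m x0 = 1" for m x by (auto simp: h_def)
  have [measurable]: "h m \<in> borel_measurable borel" for m unfolding h_def by measurable
  have h_cont: "isCont (h m) x" for m x unfolding h_def by (intro continuous_intros)
  have h_int: "integrable N (h m)" if "real_distribution N" for N m
  proof -
    interpret N: real_distribution N by (rule that)
    show ?thesis by (rule N.integrable_const_bound[where B=1]) (use h in auto)
  qed
  have h_ge: "\<rho> \<le> (\<integral>x. h m x \<partial>\<nu>)" for m
  proof (rule tendsto_lowerbound)
    show "(\<lambda>n. \<integral>x. h m x \<partial>M n) \<longlonglongrightarrow> (\<integral>x. h m x \<partial>\<nu>)"
      by (rule weak_conv_imp_integral_bdd_continuous_conv[OF rd rd' conv, where B=1])
         (use h h_cont in auto)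
    have "\<rho> \<le> (\<integral>x. h m x \<partial>M n)" for n
    proof -
      interpret N: real_distribution "M n" by (rule rd)
      have "\<rho> \<le> (\<integral>x. indicator {x0} x \<partial>M n)" using atom[of n] by simp
      also have "\<dots> \<le> (\<integral>x. h m x \<partial>M n)"
        by (intro integral_mono h_int rd integrable_real_indicator)
           (use h in \<open>auto simp: indicator_def N.emeasure_eq_measure\<close>)
      finally show ?thesis .
    qed
    then show "\<forall>\<^sub>F n in sequentially. \<rho> \<le> (\<integral>x. h m x \<partial>M n)" by simp
  qed simp
  have "(\<lambda>m. \<integral>x. h m x \<partial>\<nu>) \<longlonglongrightarrow> (\<integral>x. indicator {x0} x \<partial>\<nu>)"
  proof (rule integral_dominated_convergence[where w="\<lambda>_. 1"])
    show "AE x in \<nu>. (\<lambda>m. h m x) \<longlonglongrightarrow> indicator {x0} x"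
    proof (rule AE_I2, rule tendsto_eventually)
      fix x
      show "\<forall>\<^sub>F m in sequentially. h m x = indicator {x0} x"
      proof (cases "x = x0")
        case False
        obtain N :: nat where N: "1 / \<bar>x - x0\<bar> \<le> real N" using real_arch_simple by blast
        have "h m x = 0" if "m \<ge> N" for m
        proof -
          have "1 / \<bar>x - x0\<bar> \<le> real m" using N that by linarith
          then have "1 \<le> real m * \<bar>x - x0\<bar>" using False by (simp add: field_simps)
          then show ?thesis by (simp add: h_def)
        qed
        then show ?thesis using False by (auto simp: eventually_sequentially)
      qed (simp add: h_def)
    qed
  qed (use h in auto)
  from tendsto_lowerbound[OF this] h_ge show ?thesis by simp
qed

section \<open>Indeterminacy\<close>

context jacobi_polys
begin

lemma q_nonzero: "q (n + 1) \<noteq> 0"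
  using degree_q[of n] q_1 by (cases n) auto

lemma truncated_solution_with_atom:
  assumes mom: "has_moments \<mu> s"
    and orth: "\<And>j k. (\<integral>x. poly (q (j + 1)) x * poly (q (k + 1)) x \<partial>\<mu>) = (if j = k then 1 else 0)"
    and N: "N \<ge> 1" and x0: "poly (q N) x0 \<noteq> 0"
  shows "\<exists>M. real_distribution M \<and> (\<forall>k. integrable M (\<lambda>x. x ^ k)) \<and>
     (\<forall>k. k + 2 \<le> 2 * N \<longrightarrow> (\<integral>x. x ^ k \<partial>M) = s k) \<and> measure M {x0} = 1 / rkern N x0"
proof -
  obtain X where X: "finite X" "x0 \<in> X" and quad:
    "\<And>j k. j < N \<Longrightarrow> k < N \<Longrightarrow>
       (\<Sum>x\<in>X. poly (q (j + 1)) x * poly (q (k + 1)) x / rkern N x) = (if j = k then 1 else 0)"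
    using quadrature_with_node[OF N x0] by blast
  define w where "w x = (if x \<in> X then 1 / rkern N x else 0)" for x
  have w0: "w x \<ge> 0" for x using rkern_pos[OF N, of x] by (simp add: w_def)
  \<comment> \<open>Exactness for \<open>q 1 * q 1\<close>, the constant 1, says that the weights
    sum to 1.\<close>
  have "(\<Sum>x\<in>X. w x) = 1" using quad[of 0 0] N q_1 by (simp add: w_def)
  have w_sum: "(\<integral>\<^sup>+ x. ennreal (w x) \<partial>count_space UNIV) = 1"
  proof -
    have "(\<integral>\<^sup>+ x. ennreal (w x) \<partial>count_space UNIV) = (\<Sum>x\<in>X. ennreal (w x))"
      using X by (intro nn_integral_count_space') (auto simp: w_def)
    also have "\<dots> = ennreal (\<Sum>x\<in>X. w x)" using w0 by simp
    finally show ?thesis using \<open>(\<Sum>x\<in>X. w x) = 1\<close> by simp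
  qed
  define p where "p = embed_pmf w"
  have pmf_p: "pmf p x = w x" for x unfolding p_def by (rule pmf_embed_pmf[OF w0 w_sum])
  have set_p: "set_pmf p \<subseteq> X" by (auto simp: set_pmf_iff pmf_p w_def split: if_splits)
  have fin_p: "finite (set_pmf p)" using set_p X(1) by (rule finite_subset)
  have int_p: "(\<integral>x. f x \<partial>measure_pmf p) = (\<Sum>x\<in>X. f x * w x)" for f :: "real \<Rightarrow> real"
    using integral_measure_pmf_real[OF X(1), of p f] set_p by (auto simp: pmf_p)
  define M where "M = distr (measure_pmf p) borel id"
  have "integrable M (\<lambda>x. x ^ k)" for k
    unfolding M_def by (subst integrable_distr_eq) (auto intro: integrable_measure_pmf_finite[OF fin_p])
  moreover have "(\<integral>x. x ^ k \<partial>M) = s k" if k: "k + 2 \<le> 2 * N" for k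
  proof -
    have int_poly: "integrable \<mu> (\<lambda>x. poly f x)" for f :: "real poly"
      unfolding poly_altdef using mom
      by (intro Bochner_Integration.integrable_sum integrable_mult_right) (auto simp: has_moments_def)
    define L1 where "L1 f = (\<Sum>x\<in>X. poly f x * w x)" for f
    define L2 where "L2 f = (\<integral>x. poly f x \<partial>\<mu>)" for f
    have "L1 (monom 1 k) = L2 (monom 1 k)"
    proof (rule functionals_agree[of L1 N L2, OF _ _ _ _ _ _ k])
      show "L1 (f + g) = L1 f + L1 g" for f g by (simp add: L1_def sum.distrib algebra_simps)
      show "L1 (smult c f) = c * L1 f" for c f by (simp add: L1_def sum_distrib_left mult.assoc)
      show "L1 (q (i + 1) * q (j + 1)) = (if i = j then 1 else 0)" if "i < N" "j < N" for i j
        using quad[OF that] by (simp add: L1_def w_def)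
      show "L2 (f + g) = L2 f + L2 g" for f g using int_poly by (simp add: L2_def)
      show "L2 (smult c f) = c * L2 f" for c f by (simp add: L2_def)
      show "L2 (q (i + 1) * q (j + 1)) = (if i = j then 1 else 0)" for i j
        using orth[of i j] by (simp add: L2_def)
    qed
    moreover have "(\<integral>x. x ^ k \<partial>M) = L1 (monom 1 k)"
      unfolding M_def L1_def by (subst integral_distr) (auto simp: int_p poly_monom)
    moreover have "L2 (monom 1 k) = s k"
      using mom by (simp add: L2_def poly_monom has_moments_def)
    ultimately show ?thesis by simp
  qed
  moreover have "measure M {x0} = 1 / rkern N x0"
  proof -
    have "measure M {x0} = measure (measure_pmf p) {x0}"
      unfolding M_def by (subst measure_distr) auto
    then show ?thesis using X(2) by (simp add: measure_pmf_single pmf_p w_def)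
  qed
  moreover have "real_distribution M" unfolding M_def by (rule real_distribution_pmf)
  ultimately show ?thesis by blast
qed

theorem indeterminate_of_summable:
  assumes ham: "normalized_hamburger \<mu> s"
    and orth: "\<And>j k. (\<integral>x. poly (q (j + 1)) x * poly (q (k + 1)) x \<partial>\<mu>) = (if j = k then 1 else 0)"
    and summable: "\<And>x. summable (\<lambda>k. (poly (q (k + 1)) x)\<^sup>2)"
  shows "indeterminate s"
proof -
  interpret \<mu>: prob_space \<mu> using ham by (simp add: normalized_hamburger_def)
  have mom: "has_moments \<mu> s" using ham by (simp add: normalized_hamburger_def)
  \<comment> \<open>Both parts are countable: each polynomial has finitely many zeros, and a
    probability measure has countably many atoms.\<close>
  define bad where "bad = (\<Union>n. {x. poly (q (n + 1)) x = 0}) \<union> {x. measure \<mu> {x} \<noteq> 0}"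
  have "countable (\<Union>n. {x. poly (q (n + 1)) x = 0})"
    by (rule countable_UN) (simp_all only: countableI_type countable_finite[OF poly_roots_finite[OF q_nonzero]])
  then have "countable bad"
    unfolding bad_def using \<mu>.countable_support by (rule countable_Un)
  then have "bad \<noteq> UNIV" using uncountable_UNIV_real by auto
  then obtain x0 where "x0 \<notin> bad" by blast
  then have x0: "\<And>n. poly (q (n + 1)) x0 \<noteq> 0" "measure \<mu> {x0} = 0" by (auto simp: bad_def)
  define T where "T = (\<Sum>k. (poly (q (k + 1)) x0)\<^sup>2)"
  have rkern_le: "rkern N x0 \<le> T" for N
    unfolding rkern_def T_def using summable by (intro sum_le_suminf) auto
  have T: "T > 0" using rkern_pos[of 1 x0] rkern_le[of 1] by linarith
  \<comment> \<open>Starting at N = n + 2 gives every measure of the sequence the second moment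
    \<open>s 2\<close>, which yields tightness.\<close>
  have "\<exists>M. real_distribution M \<and> (\<forall>k. integrable M (\<lambda>x. x ^ k)) \<and>
     (\<forall>k. k + 2 \<le> 2 * (n + 2) \<longrightarrow> (\<integral>x. x ^ k \<partial>M) = s k) \<and> measure M {x0} = 1 / rkern (n + 2) x0" for n
    by (rule truncated_solution_with_atom[OF mom orth]) (use x0(1)[of "n + 1"] in auto)
  then obtain M where M: "\<And>n. real_distribution (M n)" "\<And>n k. integrable (M n) (\<lambda>x. x ^ k)"
    "\<And>n k. k + 2 \<le> 2 * (n + 2) \<Longrightarrow> (\<integral>x. x ^ k \<partial>M n) = s k"
    "\<And>n. measure (M n) {x0} = 1 / rkern (n + 2) x0" by metis
  have "tight M"
    using M by (intro tight_of_second_moment[where v="s 2"]) auto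
  from tight_imp_convergent_subsubsequence[OF this strict_mono_id]
  obtain r \<nu> where r: "strict_mono r" "real_distribution \<nu>" "weak_conv_m (M \<circ> id \<circ> r) \<nu>" by blast
  have "has_moments \<nu> s"
  proof (rule weak_limit_moments[OF _ r(2,3)])
    show "\<forall>\<^sub>F n in sequentially. (\<integral>x. x ^ k \<partial>(M \<circ> id \<circ> r) n) = s k" for k
      unfolding eventually_sequentially
    proof (intro exI allI impI)
      fix n assume "k \<le> n"
      also have "n \<le> r n" by (rule seq_suble[OF r(1)])
      finally show "(\<integral>x. x ^ k \<partial>(M \<circ> id \<circ> r) n) = s k" by (simp add: M(3))
    qed
  qed (use M in auto)
  moreover have "1 / T \<le> measure \<nu> {x0}"
  proof (rule weak_limit_atom[OF _ r(2,3)])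
    fix n
    have "1 / T \<le> 1 / rkern (r n + 2) x0"
      using rkern_le rkern_pos[of "r n + 2" x0] T by (intro divide_left_mono) auto
    then show "1 / T \<le> measure ((M \<circ> id \<circ> r) n) {x0}" by (simp add: M(4))
  qed (use M in auto)
  then have "\<nu> \<noteq> \<mu>" using x0(2) T by (auto simp: divide_le_0_iff)
  ultimately show ?thesis using mom unfolding indeterminate_def by blast
qed

end

section \<open>Integer-indexed recurrences\<close>

lemma nat_indexed_recurrence:
  assumes "solves_recurrence a b r"
  shows "z * r (int (n + 1) - 1) z = of_real (b (int (n + 1) - 1)) * r (int (n + 2) - 1) z
      + of_real (a (int n)) * r (int (n + 1) - 1) z + of_real (b (int n - 1)) * r (int n - 1) z"
  using assms[unfolded solves_recurrence_def, rule_format, of "int n" z] by (simp add: algebra_simps)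

lemma all_nonneg_int_iff: "(\<forall>n\<ge>0. \<Phi> n) \<longleftrightarrow> (\<forall>n. \<Phi> (int n))"
  by (metis nonneg_int_cases of_nat_0_le_iff)

theorem theorem4p2:
  fixes a b :: "int \<Rightarrow> real" and s :: "nat \<Rightarrow> real" and \<mu> :: "real measure"
    and P Q :: "int \<Rightarrow> real poly"
  assumes "normalized_hamburger \<mu> s"
    and "\<And>n. n \<ge> 0 \<Longrightarrow> b n > 0" and "b (-1) = 1"
    and "orthonormal_polys \<mu> P" and "polys_first_kind a b P"
    and "polys_second_kind a b Q"
    and "summable (\<lambda>k::nat. let n = int k + 1 in (1 + \<bar>a n\<bar>) / sqrt (b n * b (n - 1)))"
    and "\<exists>n0\<ge>1. (\<forall>n\<ge>n0. (b n)\<^sup>2 \<le> b (n - 1) * b (n + 1)) \<or>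
                  (\<forall>n\<ge>n0. (b n)\<^sup>2 \<ge> b (n - 1) * b (n + 1))"
  shows "(\<forall>x::real. convergent_prod (\<lambda>k::nat. 1 + x / b (int k - 1))) \<and>
    (\<forall>r. nontrivial_solution a b r \<longrightarrow>
       (\<exists>c. \<forall>z. \<forall>n\<ge>0. sqrt (b (n - 1)) * cmod (r n z) \<le> c * Pi_fun b (cmod z)) \<and>
       (\<forall>z. \<exists>K>0. \<forall>n\<ge>0. max (cmod (r n z)) (cmod (r (n + 1) z)) \<ge> K / sqrt (b (n + 1)))) \<and>
    (\<lambda>n::nat. (poly (P (int n)) 0)\<^sup>2) \<in> O(\<lambda>n. 1 / b (int n - 1)) \<and>
    (\<lambda>n::nat. (poly (Q (int n)) 0)\<^sup>2) \<in> O(\<lambda>n. 1 / b (int n - 1)) \<and>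
    (\<forall>r. nontrivial_solution a b r \<longrightarrow>
       (\<forall>z. \<exists>K>0. \<exists>L>0. \<forall>n\<ge>0.
          K / b (n + 1) \<le> (cmod (r n z))\<^sup>2 + (cmod (r (n + 1) z))\<^sup>2 \<and>
          (cmod (r n z))\<^sup>2 + (cmod (r (n + 1) z))\<^sup>2 \<le> L / b (n - 1))) \<and>
    indeterminate s"
proof -
  define A B where "A n = a (int n)" and "B n = b (int n - 1)" for n
  have B_pos: "B n > 0" for n
    using assms(2)[of "int n - 1"] assms(3) by (cases n) (auto simp: B_def)
  interpret log_regular A B
  proof
    show "summable (\<lambda>n. (1 + \<bar>A (n + 1)\<bar>) / sqrt (B (n + 2) * B (n + 1)))"
      using assms(7) by (simp add: A_def B_def Let_def algebra_simps)
    from assms(8) obtain n0 where n0: "n0 \<ge> 1" "(\<forall>n\<ge>n0. (b n)\<^sup>2 \<le> b (n - 1) * b (n + 1)) \<or>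
                  (\<forall>n\<ge>n0. (b n)\<^sup>2 \<ge> b (n - 1) * b (n + 1))" by blast
    have eqs: "B (m + 1) = b (int m)" "B (m + 2) = b (int m + 1)" for m
      by (simp_all add: B_def add.commute)
    have large: "int m \<ge> n0" if "m \<ge> nat n0" for m using that by linarith
    from n0(2) show "\<exists>m0. (\<forall>m\<ge>m0. (B (m + 1))\<^sup>2 \<le> B m * B (m + 2)) \<or>
                       (\<forall>m\<ge>m0. (B (m + 1))\<^sup>2 \<ge> B m * B (m + 2))"
    proof
      assume "\<forall>n\<ge>n0. (b n)\<^sup>2 \<le> b (n - 1) * b (n + 1)"
      then have "(B (m + 1))\<^sup>2 \<le> B m * B (m + 2)" if "m \<ge> nat n0" for m
        using large[OF that] by (simp add: eqs(1)[of m, simplified] eqs(2)[of m, simplified] B_def[of m])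
      then show ?thesis by blast
    next
      assume "\<forall>n\<ge>n0. (b n)\<^sup>2 \<ge> b (n - 1) * b (n + 1)"
      then have "(B (m + 1))\<^sup>2 \<ge> B m * B (m + 2)" if "m \<ge> nat n0" for m
        using large[OF that] by (simp add: eqs(1)[of m, simplified] eqs(2)[of m, simplified] B_def[of m])
      then show ?thesis by blast
    qed
  qed (rule B_pos)
  have Pi: "Pi_fun b x = (\<Prod>k. 1 + x / B k)" for x by (simp add: Pi_fun_def B_def)
  have sol: "\<exists>\<rho>0 \<rho>1. (\<rho>0, \<rho>1) \<noteq> (0, 0) \<and> log_regular_solution A B (\<lambda>n. r (int n - 1)) \<rho>0 \<rho>1"
    if r: "nontrivial_solution a b r" for r
  proof -
    from r obtain \<alpha> \<beta> where ab: "(\<alpha>, \<beta>) \<noteq> (0, 0)" "\<And>z. r 0 z = \<alpha>" "\<And>z. r (-1) z = \<beta>"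
      and rec: "solves_recurrence a b r"
      unfolding nontrivial_solution_def by blast
    \<comment> \<open>The initial values change order, since the shifted sequence begins with
      r_{-1}.\<close>
    have "log_regular_solution A B (\<lambda>n. r (int n - 1)) \<beta> \<alpha>"
    proof
      show "z * r (int (n + 1) - 1) z = of_real (B (n + 1)) * r (int (n + 2) - 1) z
          + of_real (A n) * r (int (n + 1) - 1) z + of_real (B n) * r (int n - 1) z" for n z
        unfolding A_def B_def by (rule nat_indexed_recurrence[OF rec])
    qed (simp_all add: ab)
    with ab(1) show ?thesis by blast
  qed
  have shift: "b (int n - 1) = B n" "b (int n + 1) = B (n + 2)" for n
    by (simp_all add: B_def add.commute)
  have upper: "\<exists>c. \<forall>z. \<forall>n\<ge>0. sqrt (b (n - 1)) * cmod (r n z) \<le> c * Pi_fun b (cmod z)"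
    and lower: "\<forall>z. \<exists>K>0. \<forall>n\<ge>0. max (cmod (r n z)) (cmod (r (n + 1) z)) \<ge> K / sqrt (b (n + 1))"
    and squares: "\<forall>z. \<exists>K>0. \<exists>L>0. \<forall>n\<ge>0.
          K / b (n + 1) \<le> (cmod (r n z))\<^sup>2 + (cmod (r (n + 1) z))\<^sup>2 \<and>
          (cmod (r n z))\<^sup>2 + (cmod (r (n + 1) z))\<^sup>2 \<le> L / b (n - 1)"
    and square_bound: "\<And>z. \<exists>C>0. \<forall>n. (cmod (r (int n) z))\<^sup>2 \<le> C / B n"
    if r: "nontrivial_solution a b r" for r
  proof -
    from sol[OF r] obtain \<rho>0 \<rho>1 where nz: "(\<rho>0, \<rho>1) \<noteq> (0, 0)"
      and "log_regular_solution A B (\<lambda>n. r (int n - 1)) \<rho>0 \<rho>1" by blast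
    then interpret S: log_regular_solution A B "\<lambda>n. r (int n - 1)" \<rho>0 \<rho>1 by simp
    have i: "int (n + 1) - 1 = int n" "int (n + 2) - 1 = int n + 1" for n by simp_all
    show "\<exists>c. \<forall>z. \<forall>n\<ge>0. sqrt (b (n - 1)) * cmod (r n z) \<le> c * Pi_fun b (cmod z)"
      using S.upper_bound unfolding all_nonneg_int_iff Pi i shift(1) .
    show "\<forall>z. \<exists>K>0. \<forall>n\<ge>0. max (cmod (r n z)) (cmod (r (n + 1) z)) \<ge> K / sqrt (b (n + 1))"
      using S.lower_bound[OF nz] unfolding all_nonneg_int_iff i shift(2) by blast
    show "\<forall>z. \<exists>K>0. \<exists>L>0. \<forall>n\<ge>0.
          K / b (n + 1) \<le> (cmod (r n z))\<^sup>2 + (cmod (r (n + 1) z))\<^sup>2 \<and>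
          (cmod (r n z))\<^sup>2 + (cmod (r (n + 1) z))\<^sup>2 \<le> L / b (n - 1)"
      using S.square_sum_bounds[OF nz] unfolding all_nonneg_int_iff i shift(1,2) by blast
    show "\<exists>C>0. \<forall>n. (cmod (r (int n) z))\<^sup>2 \<le> C / B n" for z
      using S.square_upper_bound[of z] unfolding i .
  qed
  have P: "nontrivial_solution a b (\<lambda>n. cpoly (P n))" and P_rec: "solves_recurrence a b (\<lambda>n. cpoly (P n))"
    and P_init: "P 0 = 1" "P (-1) = 0"
    using assms(5) by (auto simp: polys_first_kind_def nontrivial_solution_def cpoly_def)
  have "cpoly 0 z = 0" "cpoly (-1) z = -1" for z
    by (simp_all add: cpoly_def one_pCons map_poly_pCons)
  then have Q: "nontrivial_solution a b (\<lambda>n. cpoly (Q n))"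
    using assms(6) by (auto simp: polys_second_kind_def nontrivial_solution_def)
  \<comment> \<open>Used at 0 for the O-estimates, and at every real point, with summability of
    \<open>1 / B n\<close>, for indeterminacy.\<close>
  have real_square_bound: "\<exists>C>0. \<forall>n. (poly (p (int n)) x)\<^sup>2 \<le> C / B n"
    if "nontrivial_solution a b (\<lambda>n. cpoly (p n))" for p :: "int \<Rightarrow> real poly" and x
    using square_bound[OF that, of "of_real x"] by simp
  have bigo: "(\<lambda>n::nat. (poly (p (int n)) 0)\<^sup>2) \<in> O(\<lambda>n. 1 / b (int n - 1))"
    if p: "nontrivial_solution a b (\<lambda>n. cpoly (p n))" for p :: "int \<Rightarrow> real poly"
  proof -
    obtain C where C: "\<And>n. (poly (p (int n)) 0)\<^sup>2 \<le> C / B n"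
      using real_square_bound[OF p, of 0] by blast
    show ?thesis
      by (rule bigoI[of _ C]) (use C B_pos in \<open>simp add: shift(1) less_imp_le\<close>)
  qed
  interpret J: jacobi_polys A B "\<lambda>n. P (int n - 1)"
  proof
    show "degree (P (int (n + 1) - 1)) = n" for n
      using assms(4) by (simp add: orthonormal_polys_def)
    show "z * cpoly (P (int (n + 1) - 1)) z = of_real (B (n + 1)) * cpoly (P (int (n + 2) - 1)) z
        + of_real (A n) * cpoly (P (int (n + 1) - 1)) z + of_real (B n) * cpoly (P (int n - 1)) z" for n z
      unfolding A_def B_def by (rule nat_indexed_recurrence[OF P_rec])
  qed (simp_all add: B_pos P_init)
  have indet: "indeterminate s"
  proof (rule J.indeterminate_of_summable[OF assms(1)])
    show "(\<integral>x. poly (P (int (j + 1) - 1)) x * poly (P (int (k + 1) - 1)) x \<partial>\<mu>) = (if j = k then 1 else 0)" for j k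
      using assms(4) by (simp add: orthonormal_polys_def)
    show "summable (\<lambda>k. (poly (P (int (k + 1) - 1)) x)\<^sup>2)" for x
    proof -
      obtain C where C: "\<And>n. (poly (P (int n)) x)\<^sup>2 \<le> C / B n"
        using real_square_bound[OF P, of x] by blast
      have "summable (\<lambda>n. C * (1 / B n))" by (intro summable_mult summable_inverse)
      then show ?thesis
        by (rule summable_comparison_test') (use C in auto)
    qed
  qed
  have conv: "\<forall>x::real. convergent_prod (\<lambda>k::nat. 1 + x / b (int k - 1))"
    using convergent_prod_inverse unfolding B_def by blast
  show ?thesis
    by (intro conjI conv indet bigo P Q; rule allI; rule impI; (rule conjI)?;
        (erule upper | erule lower | erule squares))
qed

end
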